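(* Let $f:(M,h)\to(N,g)$ be a holomorphic map between two Hermitian manifolds. Then the following inequality of real $(1,1)$-forms holds on $\mathbb P(\pi^*f^*T^*_N)\to\mathbb P(T_M)$: $$\sqrt{-1}\,\partial\bar\partial\,\mathscr Y_2\ \ge\ \left(\sqrt{-1}\,\partial\bar\partial\log\mathscr H^{-1}+\sqrt{-1}\,\partial\bar\partial\log\mathscr H_1^{-1}\right)\cdot\mathscr Y_2 .$$
   Context: $\{z^\alpha\}_{\alpha=1}^m$ and $\{\eta^i\}_{i=1}^n$ are local holomorphic coordinates on $M$ (near $p$) and $N$ (near $f(p)$); $h=(h_{\alpha\bar\beta})$, $g=(g_{i\bar j})$, with $g^{i\bar j}$ the inverse matrix of $g$; $f^i_\alpha=\partial f^i/\partial z^\alpha$. Repeated indices are summed. $\pi:\mathbb P(T_M)\to M$ is the bundle whose fiber over $p$ is the set of complex lines in $T_pM=T^{1,0}_pM$, with $(W^1,\dots,W^m)$ the holomorphic fiber coordinates on $T_M$ with respect to $\partial/\partial z^\alpha$. $\mathbb P(\pi^*f^*T^*_N)\to\mathbb P(T_M)$ is the bundle of complex lines in the fibers of the holomorphic vector bundle $\pi^*f^*T_N^*$ (where $T_N=T^{1,0}N$), with $(X_1,\dots,X_n)$ the holomorphic fiber coordinates on $f^*T^*_N$ with respect to $f^*d\eta^i$. Set $\mathscr H=\sum h_{\gamma\bar\delta}W^\gamma\overline{W^\delta}$, $\mathscr H_1=\sum g^{k\bar\ell}X_k\overline{X_\ell}$ and $$\mathscr Y_2=f^i_\alpha\overline{f^j_\beta}\,\frac{X_i\overline{X_j}}{\sum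 g^{k\bar\ell}X_k\overline{X_\ell}}\cdot\frac{W^\alpha\overline{W^\beta}}{\sum h_{\gamma\bar\delta}W^\gamma\overline{W^\delta}},$$ a function on $\mathbb P(\pi^*f^*T^*_N)$. The forms $\partial\bar\partial\log\mathscr H^{-1}$ and $\partial\bar\partial\log\mathscr H_1^{-1}$ are well defined on $\mathbb P(\pi^*f^*T^*_N)$ (computed with any local holomorphic choices of homogeneous coordinates). For real $(1,1)$-forms, $A\ge B$ means that $A-B$ is semi-positive. *)

theory Defs
  imports "HOL-Analysis.Analysis"
begin

text \<open>Complex differentiability at every point, in several variables; only used on open sets.\<close>

definition hol_on :: "(complex^'m) set \<Rightarrow> (complex^'m \<Rightarrow> complex^'n) \<Rightarrow> bool" where
  "hol_on S F \<longleftrightarrow> (\<forall>z\<in>S. \<exists>A::complex^'m^'n. (F has_derivative (\<lambda>v. A *v v)) (at z))"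

text \<open>The matrix of complex partial derivatives, row \<open>i\<close> and column \<open>\<alpha>\<close> being
  \<open>\<partial>F\<^sup>i/\<partial>z\<^sup>\<alpha>\<close>.\<close>

definition complex_jacobian :: "(complex^'m \<Rightarrow> complex^'n) \<Rightarrow> complex^'m \<Rightarrow> complex^'m^'n" where
  "complex_jacobian F z = (\<chi> i \<alpha>. deriv (\<lambda>t. F (z + t *s axis \<alpha> 1) $ i) 0)"

primrec Ck_on ::
  "nat \<Rightarrow> 'e::real_normed_vector set \<Rightarrow> ('e \<Rightarrow> 'f::real_normed_vector) \<Rightarrow> bool" where
  "Ck_on 0 S F \<longleftrightarrow> continuous_on S F"
| "Ck_on (Suc k) S F \<longleftrightarrow> (\<forall>x\<in>S. F differentiable (at x)) \<and>
     (\<forall>v. Ck_on k S (\<lambda>x. frechet_derivative F (at x) v))"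

definition smooth_on ::
  "'e::real_normed_vector set \<Rightarrow> ('e \<Rightarrow> 'f::real_normed_vector) \<Rightarrow> bool" where
  "smooth_on S F \<longleftrightarrow> (\<forall>k. Ck_on k S F)"

text \<open>With \<open>\<zeta>\<^sup>a = x\<^sup>a + \<i> y\<^sup>a\<close>, these are
  \<open>\<partial>/\<partial>\<zeta>\<^sup>a = (\<partial>/\<partial>x\<^sup>a - \<i> \<partial>/\<partial>y\<^sup>a)/2\<close> and its conjugate.\<close>

definition wirtinger :: "'d::finite \<Rightarrow> (complex^'d \<Rightarrow> complex) \<Rightarrow> complex^'d \<Rightarrow> complex" where
  "wirtinger a u z =
     (frechet_derivative u (at z) (axis a 1) - \<i> * frechet_derivative u (at z) (axis a \<i>)) / 2"

definition wirtinger_bar :: "'d::finite \<Rightarrow> (complex^'d \<Rightarrow> complex) \<Rightarrow> complex^'d \<Rightarrow> complex" where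
  "wirtinger_bar a u z =
     (frechet_derivative u (at z) (axis a 1) + \<i> * frechet_derivative u (at z) (axis a \<i>)) / 2"

definition complex_hessian :: "(complex^'d \<Rightarrow> complex) \<Rightarrow> complex^'d \<Rightarrow> complex^'d^'d" where
  "complex_hessian u z = (\<chi> a b. wirtinger a (wirtinger_bar b u) z)"

text \<open>The value \<open>\<Sum> A\<^sub>\<gamma>\<^sub>\<delta> v\<^sup>\<gamma> cnj v\<^sup>\<delta>\<close>; it is already real when \<open>A\<close> is Hermitian.\<close>

definition herm :: "complex^'k^'k \<Rightarrow> complex^'k \<Rightarrow> real" where
  "herm A v = Re (\<Sum>\<gamma>\<in>UNIV. \<Sum>\<delta>\<in>UNIV. A$\<gamma>$\<delta> * v$\<gamma> * cnj (v$\<delta>))"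

definition semi_positive :: "complex^'d^'d \<Rightarrow> bool" where
  "semi_positive A \<longleftrightarrow>
     (\<forall>\<xi>::complex^'d. (\<Sum>a\<in>UNIV. \<Sum>b\<in>UNIV. A$a$b * \<xi>$a * cnj (\<xi>$b)) \<in> \<real>\<^sub>\<ge>\<^sub>0)"

text \<open>A chart is a coordinate patch together with its coordinate map.\<close>

type_synonym ('a, 'k) chart = "'a set \<times> ('a \<Rightarrow> complex^'k)"

record ('a, 'k) cmanifold =
  mtop :: "'a topology"
  charts :: "('a, 'k) chart set"

definition chart_inv :: "('a, 'k) chart \<Rightarrow> complex^'k \<Rightarrow> 'a" where
  "chart_inv c = inv_into (fst c) (snd c)"

definition complex_manifold :: "('a, 'k::finite) cmanifold \<Rightarrow> bool" where
  "complex_manifold M \<longleftrightarrow>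
     Hausdorff_space (mtop M) \<and> second_countable (mtop M) \<and>
     (\<Union>c\<in>charts M. fst c) = topspace (mtop M) \<and>
     (\<forall>c\<in>charts M. openin (mtop M) (fst c) \<and> open (snd c ` fst c) \<and>
        homeomorphic_map (subtopology (mtop M) (fst c)) (top_of_set (snd c ` fst c)) (snd c)) \<and>
     (\<forall>c\<in>charts M. \<forall>c'\<in>charts M.
        hol_on (snd c ` (fst c \<inter> fst c')) (snd c' \<circ> chart_inv c))"

definition charts_at :: "('a, 'k) cmanifold \<Rightarrow> 'a \<Rightarrow> ('a, 'k) chart set" where
  "charts_at M p = {c \<in> charts M. p \<in> fst c}"

text \<open>Entry \<open>(i, j)\<close> is \<open>\<partial>z'\<^sup>i/\<partial>z\<^sup>j\<close> at \<open>p\<close>, for the coordinates \<open>z\<close> of \<open>c\<close> and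
  \<open>z'\<close> of \<open>c'\<close>.\<close>

definition chart_change ::
  "('a, 'k::finite) chart \<Rightarrow> ('a, 'k) chart \<Rightarrow> 'a \<Rightarrow> complex^'k^'k" where
  "chart_change c c' p = complex_jacobian (snd c' \<circ> chart_inv c) (snd c p)"

text \<open>An element of \<open>T\<^sup>1\<^sup>,\<^sup>0\<close> or of its dual is given by its components in all charts around
  the point, subject to the transformation law; it is \<open>0\<close> on all other charts, so that equal
  (co)vectors are equal functions. The component vector of a tangent vector \<open>v\<close> in the chart
  \<open>c\<close> is \<open>v c\<close>, the fiber coordinates with respect to \<open>\<partial>/\<partial>z\<^sup>\<alpha>\<close>; that of a covector is taken
  with respect to \<open>dz\<^sup>\<alpha>\<close>.\<close>

type_synonym ('a, 'k) tvec = "('a, 'k) chart \<Rightarrow> complex^'k"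

definition tangent_space :: "('a, 'k::finite) cmanifold \<Rightarrow> 'a \<Rightarrow> ('a, 'k) tvec set" where
  "tangent_space M p = {v.
     (\<forall>c\<in>charts_at M p. \<forall>c'\<in>charts_at M p. v c' = chart_change c c' p *v v c) \<and>
     (\<forall>c. c \<notin> charts_at M p \<longrightarrow> v c = 0)}"

definition cotangent_space :: "('a, 'k::finite) cmanifold \<Rightarrow> 'a \<Rightarrow> ('a, 'k) tvec set" where
  "cotangent_space M p = {\<theta>.
     (\<forall>c\<in>charts_at M p. \<forall>c'\<in>charts_at M p. \<theta> c = transpose (chart_change c c' p) *v \<theta> c') \<and>
     (\<forall>c. c \<notin> charts_at M p \<longrightarrow> \<theta> c = 0)}"

definition complex_lines :: "('a, 'k::finite) tvec set \<Rightarrow> ('a, 'k) tvec set set" where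
  "complex_lines V = {L. \<exists>v\<in>V. v \<noteq> (\<lambda>_. 0) \<and> L = {(\<lambda>c. t *s v c) | t. True}}"

text \<open>A Hermitian metric, given by its smooth component matrices \<open>h\<^sub>\<alpha>\<^sub>\<beta>\<close>
  (second index conjugate) in all charts.\<close>

type_synonym ('a, 'k) metric = "('a, 'k) chart \<Rightarrow> 'a \<Rightarrow> complex^'k^'k"

definition hermitian_metric :: "('a, 'k::finite) cmanifold \<Rightarrow> ('a, 'k) metric \<Rightarrow> bool" where
  "hermitian_metric M h \<longleftrightarrow>
     (\<forall>c\<in>charts M. smooth_on (snd c ` fst c) (\<lambda>z. h c (chart_inv c z))) \<and>
     (\<forall>c\<in>charts M. \<forall>p\<in>fst c.
        (\<forall>\<alpha> \<beta>. h c p $ \<beta> $ \<alpha> = cnj (h c p $ \<alpha> $ \<beta>)) \<and>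
        (\<forall>v. v \<noteq> 0 \<longrightarrow> herm (h c p) v > 0)) \<and>
     (\<forall>c\<in>charts M. \<forall>c'\<in>charts M. \<forall>p\<in>fst c \<inter> fst c'. \<forall>\<alpha> \<beta>.
        h c p $ \<alpha> $ \<beta> =
          (\<Sum>\<gamma>\<in>UNIV. \<Sum>\<delta>\<in>UNIV. h c' p $ \<gamma> $ \<delta> *
             chart_change c c' p $ \<gamma> $ \<alpha> * cnj (chart_change c c' p $ \<delta> $ \<beta>)))"

text \<open>Entry \<open>(k, l)\<close> is \<open>g\<^sup>k\<^sup>l\<close> (second index conjugate), normalized by
  \<open>\<Sum>\<^sub>l g\<^sup>k\<^sup>l g\<^sub>j\<^sub>l = \<delta>\<^sup>k\<^sub>j\<close>. Hence
  the transpose of the matrix inverse: without it, \<open>\<Sum> g\<^sup>k\<^sup>l X\<^sub>k cnj X\<^sub>l\<close> would depend on the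
  coordinates.\<close>

definition dual_metric :: "('a, 'k::finite) metric \<Rightarrow> ('a, 'k) metric" where
  "dual_metric g c p = transpose (matrix_inv (g c p))"

definition holomorphic_map ::
  "('a, 'm::finite) cmanifold \<Rightarrow> ('b, 'n::finite) cmanifold \<Rightarrow> ('a \<Rightarrow> 'b) \<Rightarrow> bool" where
  "holomorphic_map M N f \<longleftrightarrow> continuous_map (mtop M) (mtop N) f \<and>
     (\<forall>c\<in>charts M. \<forall>d\<in>charts N.
        hol_on (snd c ` (fst c \<inter> f -` fst d)) (snd d \<circ> f \<circ> chart_inv c))"

text \<open>The form \<open>\<i> \<Sum> A\<^sub>a\<^sub>b d\<zeta>\<^sup>a \<and> d cnj \<zeta>\<^sup>b\<close> is represented by its coefficient matrices
  \<open>A\<close> in all charts; so \<open>\<i> \<partial> \<partial>bar u\<close> is represented by the complex Hessians of \<open>u\<close>.\<close>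

type_synonym ('a, 'd) form11 = "('a, 'd) chart \<Rightarrow> 'a \<Rightarrow> complex^'d^'d"

definition i_ddbar :: "('a \<Rightarrow> real) \<Rightarrow> ('a, 'd::finite) form11" where
  "i_ddbar u c q = complex_hessian (\<lambda>\<zeta>. complex_of_real (u (chart_inv c \<zeta>))) (snd c q)"

definition form_ge ::
  "('a, 'd::finite) cmanifold \<Rightarrow> ('a, 'd) form11 \<Rightarrow> ('a, 'd) form11 \<Rightarrow> bool" where
  "form_ge X A B \<longleftrightarrow> (\<forall>c\<in>charts X. \<forall>q\<in>fst c. semi_positive (A c q - B c q))"

text \<open>A point is \<open>((p, L), K)\<close>, where \<open>L\<close> is a line in the tangent space of \<open>M\<close> at \<open>p\<close> and \<open>K\<close>
  is a line in the cotangent space of \<open>N\<close> at \<open>f p\<close>.\<close>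

type_synonym ('a, 'm, 'b, 'n) ppoint = "('a \<times> ('a, 'm) tvec set) \<times> ('b, 'n) tvec set"

definition PT :: "('a, 'm::finite) cmanifold \<Rightarrow> ('a \<times> ('a, 'm) tvec set) set" where
  "PT M = {(p, L). p \<in> topspace (mtop M) \<and> L \<in> complex_lines (tangent_space M p)}"

definition PfT ::
  "('a, 'm::finite) cmanifold \<Rightarrow> ('b, 'n::finite) cmanifold \<Rightarrow> ('a \<Rightarrow> 'b)
     \<Rightarrow> ('a, 'm, 'b, 'n) ppoint set" where
  "PfT M N f = {(x, K). x \<in> PT M \<and> K \<in> complex_lines (cotangent_space N (f (fst x)))}"

definition base_pt :: "('a, 'm, 'b, 'n) ppoint \<Rightarrow> 'a" where
  "base_pt q = fst (fst q)"

definition t_line :: "('a, 'm, 'b, 'n) ppoint \<Rightarrow> ('a, 'm) tvec set" where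
  "t_line q = snd (fst q)"

definition ct_line :: "('a, 'm, 'b, 'n) ppoint \<Rightarrow> ('b, 'n) tvec set" where
  "ct_line q = snd q"

text \<open>The inhomogeneous coordinate \<open>W\<^sup>\<beta>/W\<^sup>\<alpha>\<close> of a line.\<close>

definition line_ratio :: "('a, 'k::finite) tvec set \<Rightarrow> ('a, 'k) chart \<Rightarrow> 'k \<Rightarrow> 'k \<Rightarrow> complex" where
  "line_ratio L c \<alpha> \<beta> = (THE r. \<forall>v\<in>L. v c $ \<beta> = r * v c $ \<alpha>)"

text \<open>On the patch \<open>W\<^sup>\<alpha> \<noteq> 0\<close>, \<open>X\<^sub>i \<noteq> 0\<close> the holomorphic coordinates are all \<open>z\<^sup>\<gamma>\<close>, the
  \<open>W\<^sup>\<beta>/W\<^sup>\<alpha>\<close> with \<open>\<beta> \<noteq> \<alpha>\<close> and the \<open>X\<^sub>j/X\<^sub>i\<close> with \<open>j \<noteq> i\<close>. The bijection \<open>e\<close> numbers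
  these \<open>2 m + n - 2\<close> functions by the index type \<open>'d\<close>.\<close>

definition coord_index :: "'m::finite \<Rightarrow> 'n::finite \<Rightarrow> ('m + 'm + 'n) set" where
  "coord_index \<alpha> i = range Inl \<union> (Inr \<circ> Inl) ` (- {\<alpha>}) \<union> (Inr \<circ> Inr) ` (- {i})"

definition PfT_chart ::
  "('a, 'm::finite) cmanifold \<Rightarrow> ('b, 'n::finite) cmanifold \<Rightarrow> ('a \<Rightarrow> 'b)
     \<Rightarrow> ('a, 'm) chart \<Rightarrow> ('b, 'n) chart \<Rightarrow> 'm \<Rightarrow> 'n \<Rightarrow> ('d::finite \<Rightarrow> 'm + 'm + 'n)
     \<Rightarrow> (('a, 'm, 'b, 'n) ppoint, 'd) chart" where
  "PfT_chart M N f c d \<alpha> i e =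
     ({q \<in> PfT M N f. base_pt q \<in> fst c \<and> f (base_pt q) \<in> fst d \<and>
          (\<exists>v\<in>t_line q. v c $ \<alpha> \<noteq> 0) \<and> (\<exists>\<theta>\<in>ct_line q. \<theta> d $ i \<noteq> 0)},
      \<lambda>q. \<chi> a. case e a of
          Inl \<gamma> \<Rightarrow> snd c (base_pt q) $ \<gamma>
        | Inr (Inl \<beta>) \<Rightarrow> line_ratio (t_line q) c \<alpha> \<beta>
        | Inr (Inr j) \<Rightarrow> line_ratio (ct_line q) d i j)"

definition PfT_charts ::
  "('a, 'm::finite) cmanifold \<Rightarrow> ('b, 'n::finite) cmanifold \<Rightarrow> ('a \<Rightarrow> 'b)
     \<Rightarrow> (('a, 'm, 'b, 'n) ppoint, 'd::finite) chart set" where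
  "PfT_charts M N f = {PfT_chart M N f c d \<alpha> i e | c d \<alpha> i e.
     c \<in> charts M \<and> d \<in> charts N \<and> bij_betw e UNIV (coord_index \<alpha> i)}"

definition PfT_manifold ::
  "('a, 'm::finite) cmanifold \<Rightarrow> ('b, 'n::finite) cmanifold \<Rightarrow> ('a \<Rightarrow> 'b)
     \<Rightarrow> (('a, 'm, 'b, 'n) ppoint, 'd::finite) cmanifold" where
  "PfT_manifold M N f =
     \<lparr>mtop = topology_generated_by
        {fst c \<inter> snd c -` V | c V. c \<in> (PfT_charts M N f :: (_, 'd) chart set) \<and> open V},
      charts = PfT_charts M N f\<rparr>"

text \<open>The defining expression of \<open>Y\<^sub>2\<close> in charts \<open>c\<close> of \<open>M\<close> around \<open>p\<close> and \<open>d\<close> of \<open>N\<close> around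
  \<open>f p\<close>, at homogeneous coordinates \<open>W\<close> and \<open>X\<close>.\<close>

definition Y2_coord ::
  "('a, 'm::finite) metric \<Rightarrow> ('b, 'n::finite) metric \<Rightarrow> ('a \<Rightarrow> 'b)
     \<Rightarrow> ('a, 'm) chart \<Rightarrow> ('b, 'n) chart \<Rightarrow> 'a \<Rightarrow> complex^'m \<Rightarrow> complex^'n \<Rightarrow> real" where
  "Y2_coord h g f c d p W X =
     (let F = complex_jacobian (snd d \<circ> f \<circ> chart_inv c) (snd c p) in
      Re (\<Sum>i\<in>UNIV. \<Sum>j\<in>UNIV. \<Sum>\<alpha>\<in>UNIV. \<Sum>\<beta>\<in>UNIV.
            F $ i $ \<alpha> * cnj (F $ j $ \<beta>) * X $ i * cnj (X $ j) * W $ \<alpha> * cnj (W $ \<beta>))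
        / (herm (dual_metric g d (f p)) X * herm (h c p) W))"

definition Y2 ::
  "('a, 'm::finite) cmanifold \<Rightarrow> ('a, 'm) metric \<Rightarrow> ('b, 'n::finite) cmanifold
     \<Rightarrow> ('b, 'n) metric \<Rightarrow> ('a \<Rightarrow> 'b) \<Rightarrow> ('a, 'm, 'b, 'n) ppoint \<Rightarrow> real" where
  "Y2 M h N g f q = (THE y.
     \<forall>c\<in>charts_at M (base_pt q). \<forall>d\<in>charts_at N (f (base_pt q)).
     \<forall>v\<in>t_line q - {\<lambda>_. 0}. \<forall>\<theta>\<in>ct_line q - {\<lambda>_. 0}.
       y = Y2_coord h g f c d (base_pt q) (v c) (\<theta> d))"

text \<open>Let \<open>line q\<close> be a line over the point \<open>pt q\<close>. A local holomorphic choice of homogeneous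
  coordinates near \<open>q\<close> is a nowhere zero section \<open>\<sigma>\<close> of these lines over a neighbourhood \<open>U\<close> of
  \<open>q\<close> inside the patch of the chart \<open>k\<close>, whose components in a chart \<open>c\<close> downstairs are
  holomorphic functions of the coordinates of \<open>k\<close>.\<close>

definition hom_coords ::
  "('q, 'd::finite) chart \<Rightarrow> 'q \<Rightarrow> ('q \<Rightarrow> 'x) \<Rightarrow> ('q \<Rightarrow> ('x, 'k::finite) tvec set)
     \<Rightarrow> ('x, 'k) chart \<Rightarrow> 'q set \<Rightarrow> ('q \<Rightarrow> ('x, 'k) tvec) \<Rightarrow> bool" where
  "hom_coords k q pt line c U \<sigma> \<longleftrightarrow>
     q \<in> U \<and> U \<subseteq> fst k \<and> open (snd k ` U) \<and>
     (\<forall>r\<in>U. pt r \<in> fst c \<and> \<sigma> r \<in> line r \<and> \<sigma> r \<noteq> (\<lambda>_. 0)) \<and>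
     hol_on (snd k ` U) (\<lambda>\<zeta>. \<sigma> (chart_inv k \<zeta>) c)"

text \<open>The form \<open>\<i> \<partial> \<partial>bar log H\<^sup>-\<^sup>1\<close>, where \<open>H\<close> is the squared length, with respect to the metric
  \<open>A\<close>, of local holomorphic homogeneous coordinates. Since the form does not depend on
  their choice, it is computed at each point with an arbitrary one.\<close>

definition i_ddbar_log_inv ::
  "('x, 'k::finite) cmanifold \<Rightarrow> ('x, 'k) metric \<Rightarrow> ('q \<Rightarrow> 'x) \<Rightarrow> ('q \<Rightarrow> ('x, 'k) tvec set)
     \<Rightarrow> ('q, 'd::finite) form11" where
  "i_ddbar_log_inv Z A pt line k q = (SOME B. \<exists>c\<in>charts Z. \<exists>U \<sigma>.
     hom_coords k q pt line c U \<sigma> \<and>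
     B = i_ddbar (\<lambda>r. ln (inverse (herm (A c (pt r)) (\<sigma> r c)))) k q)"

definition i_ddbar_log_inv_H ::
  "('a, 'm::finite) cmanifold \<Rightarrow> ('a, 'm) metric
     \<Rightarrow> (('a, 'm, 'b, 'n) ppoint, 'd::finite) form11" where
  "i_ddbar_log_inv_H M h = i_ddbar_log_inv M h base_pt t_line"

definition i_ddbar_log_inv_H1 ::
  "('b, 'n::finite) cmanifold \<Rightarrow> ('b, 'n) metric \<Rightarrow> ('a \<Rightarrow> 'b)
     \<Rightarrow> (('a, 'm, 'b, 'n) ppoint, 'd::finite) form11" where
  "i_ddbar_log_inv_H1 N g f = i_ddbar_log_inv N (dual_metric g) (f \<circ> base_pt) ct_line"

end

theory Submission
  imports Defs "HOL-Complex_Analysis.Cauchy_Integral_Formula"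
begin

text \<open>In local holomorphic coordinates \<open>\<zeta>\<close> of the total space, choose holomorphic homogeneous coordinates
\<open>W(\<zeta>)\<close> and \<open>X(\<zeta>)\<close>. The numerator of \<open>Y\<^sub>2\<close> is then \<open>s cnj s\<close>
for the single holomorphic function \<open>s = \<Sum> X\<^sub>i (\<partial>f\<^sup>i/\<partial>z\<^sup>\<alpha>) W\<^sup>\<alpha>\<close>, so that
\<open>Y\<^sub>2 = |s|\<^sup>2 exp \<psi>\<close> with \<open>\<psi> = log H\<^sup>-\<^sup>1 + log H\<^sub>1\<^sup>-\<^sup>1\<close>. As \<open>s\<close> is holomorphic and \<open>\<psi>\<close> is
real, differentiating twice gives

  \<open>\<partial>\<^sub>a \<partial>bar\<^sub>b Y\<^sub>2 = exp \<psi> \<theta>\<^sub>a cnj \<theta>\<^sub>b + Y\<^sub>2 \<partial>\<^sub>a \<partial>bar\<^sub>b \<psi>\<close>, where \<open>\<theta>\<^sub>a = \<partial>\<^sub>a s + s \<partial>\<^sub>a \<psi>\<close>,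

and the first term is a semi-positive matrix of rank at most one. This is
\<open>hessian_weighted_norm\<close>. The metrics enter only through the
positivity and smoothness of \<open>H\<close> and \<open>H\<^sub>1\<close>.

Three things have to be supplied around this identity.

First, regularity. Complex differentiability in several variables has to imply that derivatives
exist to all orders. Cauchy's formula on small circles writes a directional derivative as an
integral, which may be differentiated under the integral sign
(\<open>cdifferentiable_frechet_derivative\<close>). The inverse metric is as regular as the metric by
Cramer's rule.

Second, independence of choices. The forms \<open>\<i> \<partial> \<partial>bar log H\<^sup>-\<^sup>1\<close> and \<open>\<i> \<partial> \<partial>bar log H\<^sub>1\<^sup>-\<^sup>1\<close> come from some
unknown homogeneous coordinates in some unknown charts downstairs. Rather than comparing them with
preferred ones, \<open>hessian_inequality\<close> writes \<open>Y\<^sub>2\<close> itself in those same homogeneous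
coordinates; this is legitimate because its coordinate expression is invariant under scaling and
under changes of charts (\<open>Y2_eq\<close>).

Third, the charts of the total space. They are shown to be injective with open image by writing
down the inverse map explicitly (\<open>point_of\<close>); normalising one homogeneous coordinate to \<open>1\<close>
then shows that holomorphic homogeneous coordinates exist, so that the two forms are what
they should be (\<open>hom_coords_exist\<close>).\<close>


section \<open>Complex differentiability of scalar functions\<close>

text \<open>A pointwise notion, phrased through the complex linearity of the real derivative, so that the
derivative rules of real analysis yield all closure properties.\<close>

definition cdifferentiable :: "(complex^'d::finite \<Rightarrow> complex) \<Rightarrow> complex^'d \<Rightarrow> bool" where
  "cdifferentiable s z \<longleftrightarrow> (\<exists>D. (s has_derivative D) (at z) \<and> (\<forall>t v. D (t *s v) = t * D v))"

lemma cdifferentiableI: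
  assumes "(s has_derivative D) (at z)" "\<And>t v. D (t *s v) = t * D v"
  shows "cdifferentiable s z"
  using assms unfolding cdifferentiable_def by blast

lemma cdifferentiable_frechet:
  assumes "cdifferentiable s z"
  shows "(s has_derivative frechet_derivative s (at z)) (at z)"
    and "frechet_derivative s (at z) (t *s v) = t * frechet_derivative s (at z) v"
    and "s differentiable (at z)"
  using assms unfolding cdifferentiable_def
  by (metis frechet_derivative_at, metis frechet_derivative_at, metis differentiableI)

lemma cdifferentiable_const: "cdifferentiable (\<lambda>_. c) z"
  by (rule cdifferentiableI[OF has_derivative_const]) simp

lemma cdifferentiable_component: "cdifferentiable (\<lambda>z. z $ a) z"
  by (rule cdifferentiableI[of _ "\<lambda>v. v $ a"])
     (auto intro!: bounded_linear_imp_has_derivative bounded_linear_vec_nth)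

lemma cdifferentiable_add:
  assumes "cdifferentiable s z" "cdifferentiable u z"
  shows "cdifferentiable (\<lambda>z. s z + u z) z"
  by (rule cdifferentiableI[OF has_derivative_add[OF cdifferentiable_frechet(1) cdifferentiable_frechet(1)]])
     (use assms in \<open>auto simp: cdifferentiable_frechet(2) algebra_simps\<close>)

lemma cdifferentiable_mult:
  assumes "cdifferentiable s z" "cdifferentiable u z"
  shows "cdifferentiable (\<lambda>z. s z * u z) z"
  by (rule cdifferentiableI[OF has_derivative_mult[OF cdifferentiable_frechet(1) cdifferentiable_frechet(1)]])
     (use assms in \<open>auto simp: cdifferentiable_frechet(2) algebra_simps\<close>)

lemma cdifferentiable_sum:
  assumes "\<And>i. i \<in> I \<Longrightarrow> cdifferentiable (s i) z"
  shows "cdifferentiable (\<lambda>z. \<Sum>i\<in>I. s i z) z"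
  using assms by (induction I rule: infinite_finite_induct) (auto intro: cdifferentiable_const cdifferentiable_add)

lemma cdifferentiable_transform:
  assumes "cdifferentiable s z" "open S" "z \<in> S" "\<And>x. x \<in> S \<Longrightarrow> s x = u x"
  shows "cdifferentiable u z"
  using assms has_derivative_transform_within_open unfolding cdifferentiable_def by blast

text \<open>A complex linear derivative is multiplication by a matrix because it is determined by its values on
the standard basis; this reduces vector-valued holomorphic maps to scalar ones.\<close>

lemma hol_on_components:
  "hol_on S F \<longleftrightarrow> (\<forall>z\<in>S. \<forall>i. cdifferentiable (\<lambda>z. F z $ i) z)"
proof
  assume H: "hol_on S F"
  show "\<forall>z\<in>S. \<forall>i. cdifferentiable (\<lambda>z. F z $ i) z"
  proof (intro ballI allI)
    fix z i assume "z \<in> S"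
    then obtain A where A: "(F has_derivative (\<lambda>v. A *v v)) (at z)"
      using H unfolding hol_on_def by blast
    have "((\<lambda>z. F z $ i) has_derivative (\<lambda>v. (A *v v) $ i)) (at z)"
      using bounded_linear.has_derivative[OF bounded_linear_vec_nth A] .
    then show "cdifferentiable (\<lambda>z. F z $ i) z"
      by (rule cdifferentiableI) (simp add: matrix_vector_mult_def sum_distrib_left mult_ac)
  qed
next
  assume R: "\<forall>z\<in>S. \<forall>i. cdifferentiable (\<lambda>z. F z $ i) z"
  show "hol_on S F"
    unfolding hol_on_def
  proof
    fix z assume z: "z \<in> S"
    define D where "D i = frechet_derivative (\<lambda>z. F z $ i) (at z)" for i
    define A where "A = (\<chi> i j. D i (axis j 1))"
    have d: "((\<lambda>z. F z $ i) has_derivative D i) (at z)" and l: "D i (t *s v) = t * D i v" for i t v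
      using R z cdifferentiable_frechet unfolding D_def by blast+
    have lin: "linear (D i)" for i using d has_derivative_linear by blast
    have "D i v = (A *v v) $ i" for i v
    proof -
      have "v = (\<Sum>j\<in>UNIV. v $ j *s axis j 1)"
        by (simp add: basis_expansion)
      then have "D i v = D i (\<Sum>j\<in>UNIV. v $ j *s axis j 1)" by simp
      also have "\<dots> = (\<Sum>j\<in>UNIV. v $ j * D i (axis j 1))"
        unfolding linear_sum[OF lin] l ..
      finally show ?thesis by (simp add: A_def matrix_vector_mult_def mult.commute)
    qed
    then have "D i = (\<lambda>v. (A *v v) $ i)" for i by blast
    then have "((\<lambda>z. F z $ i) has_derivative (\<lambda>v. (A *v v) $ i)) (at z)" for i using d by metis
    then have "(F has_derivative (\<lambda>v. A *v v)) (at z)"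
      unfolding has_derivative_componentwise_within[of F]
      by (auto simp: Basis_vec_def inner_axis intro: has_derivative_inner_left)
    then show "\<exists>A. (F has_derivative (\<lambda>v. A *v v)) (at z)" by blast
  qed
qed

lemma cdifferentiable_compose:
  fixes F :: "complex^'d::finite \<Rightarrow> complex^'k::finite"
  assumes "cdifferentiable s (F z)" "\<And>i. cdifferentiable (\<lambda>z. F z $ i) z"
  shows "cdifferentiable (\<lambda>z. s (F z)) z"
proof -
  have "hol_on {z} F" using assms(2) by (simp add: hol_on_components)
  then obtain A where A: "(F has_derivative (\<lambda>v. A *v v)) (at z)" unfolding hol_on_def by blast
  show ?thesis
    by (rule cdifferentiableI[OF has_derivative_compose[OF A cdifferentiable_frechet(1)[OF assms(1)]]])
       (simp add: cdifferentiable_frechet(2)[OF assms(1)] matrix_vector_mult_scaleR vector_scalar_commute)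
qed

section \<open>Derivatives of holomorphic functions are holomorphic\<close>

lemma bounded_linear_scale_complex: "bounded_linear (\<lambda>t. t *s (v::complex^'d::finite))"
proof -
  have "linear (\<lambda>t. t *s v)"
    by (rule linearI) (auto simp: vec_eq_iff algebra_simps)
  then show ?thesis by (rule linear_conv_bounded_linear[THEN iffD1])
qed

lemma cdifferentiable_line:
  assumes "cdifferentiable s (w + t *s v)"
  shows "((\<lambda>t. s (w + t *s v)) has_field_derivative frechet_derivative s (at (w + t *s v)) v) (at t)"
proof -
  have "((\<lambda>t. w + t *s v) has_derivative (\<lambda>t. t *s v)) (at t)"
    using has_derivative_add[OF has_derivative_const
        bounded_linear_imp_has_derivative[OF bounded_linear_scale_complex]] by simp
  from has_derivative_compose[OF this cdifferentiable_frechet(1)[OF assms]]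
  show ?thesis
    by (simp add: cdifferentiable_frechet(2)[OF assms] has_field_derivative_def mult_commute_abs)
qed

text \<open>Cauchy's formula for the first derivative, applied to \<open>t \<mapsto> s (w + t v)\<close> on the circle of radius
\<open>r\<close>. In the parametrisation \<open>e\<close> of the circle, \<open>e' = 2 \<pi> \<i> e\<close> cancels the constant of the
formula and one of the two factors \<open>1/e\<close>. The domain of integration does not depend on \<open>w\<close>, so that
the right-hand side can be differentiated in \<open>w\<close>.\<close>

lemma cauchy_derivative_average:
  assumes r: "r > 0" and s: "\<And>t. t \<in> cball 0 r \<Longrightarrow> cdifferentiable s (w + t *s v)"
  defines "e \<equiv> \<lambda>x. of_real r * exp (2 * of_real pi * \<i> * of_real x)"
  shows "frechet_derivative s (at w) v = integral {0..1} (\<lambda>x. s (w + e x *s v) / e x)"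
proof -
  define k where "k t = s (w + t *s v)" for t
  have d: "(k has_field_derivative frechet_derivative s (at (w + t *s v)) v) (at t)" if "t \<in> cball 0 r" for t
    unfolding k_def using cdifferentiable_line[OF s[OF that]] .
  have c: "continuous_on (cball 0 r) k"
    using d DERIV_isCont continuous_at_imp_continuous_on by blast
  have h: "k holomorphic_on ball 0 r"
    using d by (meson ball_subset_cball field_differentiable_at_within field_differentiable_def holomorphic_onI subsetD)
  have "(k has_field_derivative 1 / (2 * of_real pi * \<i>) * contour_integral (circlepath 0 r) (\<lambda>u. k u / (u - 0)\<^sup>2)) (at 0)"
    using Cauchy_derivative_integral_circlepath(2)[OF c h, of 0] r by simp
  moreover have "(k has_field_derivative frechet_derivative s (at w) v) (at 0)"
    using d[of 0] r by simp
  ultimately have "frechet_derivative s (at w) v =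
      1 / (2 * of_real pi * \<i>) * contour_integral (circlepath 0 r) (\<lambda>u. k u / u\<^sup>2)"
    using DERIV_unique by fastforce
  also have "\<dots> = 1 / (2 * of_real pi * \<i>) * integral {0..1} (\<lambda>x. k (e x) / (e x)\<^sup>2 * (2 * of_real pi * \<i> * e x))"
    unfolding contour_integral_integral vector_derivative_circlepath
    by (simp add: circlepath e_def mult_ac)
  also have "\<dots> = integral {0..1} (\<lambda>x. 1 / (2 * of_real pi * \<i>) * (k (e x) / (e x)\<^sup>2 * (2 * of_real pi * \<i> * e x)))"
    by (rule integral_mult_right[symmetric])
  also have "\<dots> = integral {0..1} (\<lambda>x. k (e x) / e x)"
    using r by (intro integral_cong) (simp add: field_simps power2_eq_square e_def)
  finally show ?thesis by (simp add: k_def)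
qed

lemma cdifferentiable_imp_continuous_on:
  assumes "\<And>z. z \<in> S \<Longrightarrow> cdifferentiable s z"
  shows "continuous_on S s"
  by (meson assms cdifferentiable_frechet(3) continuous_at_imp_continuous_on differentiable_imp_continuous_within)

lemma blinfun_frechet_derivative: 
  assumes "cdifferentiable s z"
  shows "blinfun_apply (Blinfun (frechet_derivative s (at z))) = frechet_derivative s (at z)"
  using cdifferentiable_frechet(1)[OF assms] bounded_linear_Blinfun_apply has_derivative_bounded_linear by blast

text \<open>The radius \<open>\<rho>\<close> works for all centres \<open>w\<close> near \<open>z\<close> simultaneously, which is what differentiating
the Cauchy integral with respect to \<open>w\<close> requires.\<close>

lemma small_circles:
  fixes z v :: "complex^'d::finite"
  assumes "open S" "z \<in> S"
  obtains r \<rho> :: real where "r > 0" "\<rho> > 0" "\<And>w t. w \<in> ball z r \<Longrightarrow> t \<in> cball 0 \<rho> \<Longrightarrow> w + t *s v \<in> S"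
proof -
  obtain B where B: "B > 0" "\<And>t. norm (t *s v) \<le> norm t * B"
    using bounded_linear.pos_bounded[OF bounded_linear_scale_complex] by blast
  obtain r where r: "r > 0" "ball z r \<subseteq> S" using assms openE by blast
  show thesis
  proof
    \<comment> \<open>Half of the radius is spent on moving the centre \<open>w\<close>, the other half on moving along \<open>v\<close>.\<close>
    show "r/2 > 0" "r / (2 * B) > 0" using r B by auto
    fix w and t :: complex assume "w \<in> ball z (r/2)" "t \<in> cball 0 (r / (2 * B))"
    moreover from this have "norm t * B \<le> r / 2" using B by (simp add: field_simps)
    ultimately have "dist z w < r/2" "norm (t *s v) \<le> r/2" using B(2)[of t] by auto
    then have "dist z (w + t *s v) < r"
      using norm_triangle_ineq4[of "z - w" "t *s v"] by (simp add: dist_norm algebra_simps)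
    then show "w + t *s v \<in> S" using r by auto
  qed
qed

text \<open>Differentiation under the integral sign needs a jointly continuous derivative of the integrand. Here
this is obtained from the integral formula itself, whose right-hand side depends continuously on \<open>w\<close>
as soon as \<open>s\<close> is continuous.\<close>

lemma continuous_on_frechet_holomorphic:
  fixes s :: "complex^'d::finite \<Rightarrow> complex"
  assumes S: "open S" and s: "\<And>z. z \<in> S \<Longrightarrow> cdifferentiable s z"
  shows "continuous_on S (\<lambda>z. frechet_derivative s (at z) v)"
  unfolding continuous_on_eq_continuous_at[OF S]
proof
  fix z assume z: "z \<in> S"
  obtain r \<rho> where r: "r > 0" "\<rho> > 0" "\<And>w t. w \<in> ball z r \<Longrightarrow> t \<in> cball 0 \<rho> \<Longrightarrow> w + t *s v \<in> S"
    using small_circles[OF S z] by blast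
  define e where "e x = of_real \<rho> * exp (2 * of_real pi * \<i> * of_real x)" for x
  have e: "e x \<in> cball 0 \<rho>" "e x \<noteq> 0" for x using r by (auto simp: e_def norm_mult)
  have "continuous_on (ball z r \<times> cbox 0 1) (\<lambda>(w, x). s (w + e x *s v) / e x)"
    unfolding split_beta
  proof (intro continuous_on_divide)
    show "continuous_on (ball z r \<times> cbox 0 1) (\<lambda>p. s (fst p + e (snd p) *s v))"
    proof (rule continuous_on_compose2[OF cdifferentiable_imp_continuous_on[OF s]])
      show "continuous_on (ball z r \<times> cbox 0 1) (\<lambda>p. fst p + e (snd p) *s v)"
        unfolding e_def
        by (intro continuous_intros bounded_linear.continuous_on[OF bounded_linear_scale_complex])
    qed (use r e in auto)
    show "continuous_on (ball z r \<times> cbox 0 1) (\<lambda>p. e (snd p))"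
      unfolding e_def by (intro continuous_intros)
  qed (use e in auto)
  from integral_continuous_on_param[OF this]
  have "continuous_on (ball z r) (\<lambda>w. integral {0..1} (\<lambda>x. s (w + e x *s v) / e x))"
    by simp
  moreover have "integral {0..1} (\<lambda>x. s (w + e x *s v) / e x) = frechet_derivative s (at w) v"
    if "w \<in> ball z r" for w
    unfolding e_def using cauchy_derivative_average[OF r(2), symmetric] r(3) s that by blast
  ultimately have "continuous_on (ball z r) (\<lambda>w. frechet_derivative s (at w) v)"
    by (rule continuous_on_eq)
  then show "isCont (\<lambda>z. frechet_derivative s (at z) v) z"
    using r(1) by (simp add: continuous_on_eq_continuous_at)
qed

text \<open>Differentiating the Cauchy integral with respect to its centre \<open>w\<close>. The derivative of the integrand
is complex linear in the direction, and integration over the circle keeps it so; hence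
holomorphic functions can be differentiated again and again.\<close>

lemma cdifferentiable_frechet_derivative:
  fixes s :: "complex^'d::finite \<Rightarrow> complex"
  assumes S: "open S" and s: "\<And>z. z \<in> S \<Longrightarrow> cdifferentiable s z" and z: "z \<in> S"
  shows "cdifferentiable (\<lambda>z. frechet_derivative s (at z) v) z"
proof -
  obtain r \<rho> where r: "r > 0" "\<rho> > 0" "\<And>w t. w \<in> ball z r \<Longrightarrow> t \<in> cball 0 \<rho> \<Longrightarrow> w + t *s v \<in> S"
    using small_circles[OF S z] by blast
  define e where "e x = of_real \<rho> * exp (2 * of_real pi * \<i> * of_real x)" for x
  have e: "e x \<in> cball 0 \<rho>" "e x \<noteq> 0" for x using r by (auto simp: e_def norm_mult)
  \<comment> \<open>The rule for differentiating under the integral sign takes derivatives as bounded linear maps.\<close>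
  define Ds where "Ds z = Blinfun (frechet_derivative s (at z))" for z
  have Ds: "blinfun_apply (Ds z) = frechet_derivative s (at z)" if "z \<in> S" for z
    unfolding Ds_def using blinfun_frechet_derivative[OF s[OF that]] .
  have cont: "continuous_on S Ds"
  proof (rule continuous_on_blinfun_componentwise)
    fix i show "continuous_on S (\<lambda>x. blinfun_apply (Ds x) i)"
      using continuous_on_frechet_holomorphic[OF S s] Ds by (simp cong: continuous_on_cong)
  qed
  define fx where "fx w x = blinfun_mult_left (inverse (e x)) o\<^sub>L Ds (w + e x *s v)" for w x
  have move: "continuous_on A (\<lambda>p. g p + e (k p) *s v)" if "continuous_on A g" "continuous_on A k"
    for A :: "'x::topological_space set" and g k
    unfolding e_def
    by (intro continuous_intros bounded_linear.continuous_on[OF bounded_linear_scale_complex] that)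
  have ce: "continuous_on A (\<lambda>p. e (k p))" if "continuous_on A k"
    for A :: "'x::topological_space set" and k
    unfolding e_def by (intro continuous_intros that)
  have cfx: "continuous_on (ball z r \<times> cbox 0 1) (\<lambda>(w, x). fx w x)"
    unfolding split_beta fx_def
  proof (rule bounded_bilinear.continuous_on[OF bounded_bilinear_blinfun_compose])
    show "continuous_on (ball z r \<times> cbox 0 1) (\<lambda>p. Ds (fst p + e (snd p) *s v))"
      by (rule continuous_on_compose2[OF cont move]) (use r e in \<open>auto intro!: continuous_intros\<close>)
    show "continuous_on (ball z r \<times> cbox 0 1) (\<lambda>p. blinfun_mult_left (inverse (e (snd p))))"
      by (intro bounded_linear.continuous_on[OF bounded_linear_blinfun_mult_left] continuous_on_inverse ce continuous_intros)
        (use e in auto)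
  qed
  have "((\<lambda>w. integral (cbox 0 1) (\<lambda>x. s (w + e x *s v) / e x)) has_derivative
     blinfun_apply (integral (cbox 0 1) (fx z))) (at z within ball z r)"
  proof (rule leibniz_rule)
    show "continuous_on (ball z r \<times> cbox 0 1) (\<lambda>(w, x). fx w x)" by (fact cfx)
    fix w :: "complex^'d" and x :: real assume w: "w \<in> ball z r"
    then have S': "w + e x *s v \<in> S" using r e by blast
    have "((\<lambda>w. w + e x *s v) has_derivative (\<lambda>w. w)) (at w)"
      by (auto intro!: derivative_eq_intros)
    from has_derivative_compose[OF this cdifferentiable_frechet(1)[OF s[OF S']]]
    have "((\<lambda>w. s (w + e x *s v)) has_derivative frechet_derivative s (at (w + e x *s v))) (at w)" .
    moreover have "blinfun_apply (fx w x) =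
        (\<lambda>u. frechet_derivative s (at (w + e x *s v)) u * inverse (e x))"
      by (rule ext) (simp add: fx_def Ds[OF S'])
    ultimately show "((\<lambda>w. s (w + e x *s v) / e x) has_derivative blinfun_apply (fx w x)) (at w within ball z r)"
      using has_derivative_mult_left[of _ _ "at w", THEN has_derivative_at_withinI]
      by (simp add: divide_inverse)
  next
    fix w assume w: "w \<in> ball z r"
    show "(\<lambda>x. s (w + e x *s v) / e x) integrable_on cbox 0 1"
      by (intro integrable_continuous continuous_on_divide ce
            continuous_on_compose2[OF cdifferentiable_imp_continuous_on[OF s] move] continuous_intros)
         (use e w r in auto)
  qed (use r in auto)
  then have "((\<lambda>w. frechet_derivative s (at w) v) has_derivative
     blinfun_apply (integral (cbox 0 1) (fx z))) (at z within ball z r)"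
  proof (rule has_derivative_transform[rotated 2])
    fix w assume "w \<in> ball z r"
    then show "frechet_derivative s (at w) v = integral (cbox 0 1) (\<lambda>x. s (w + e x *s v) / e x)"
      unfolding e_def cbox_interval using cauchy_derivative_average[OF r(2)] r(3) s by blast
  qed (use r in auto)
  then have "((\<lambda>w. frechet_derivative s (at w) v) has_derivative
     blinfun_apply (integral (cbox 0 1) (fx z))) (at z)"
    using r(1) by (simp add: at_within_open[of z "ball z r"])
  then show ?thesis
  proof (rule cdifferentiableI)
    fix t u
    \<comment> \<open>Integrability allows evaluating the integral of linear maps at a direction \<open>u\<close> under the integral.\<close>
    have "continuous_on (cbox 0 1) (fx z)"
      using continuous_on_compose2[OF cfx
          continuous_on_Pair[OF continuous_on_const[of _ z] continuous_on_id[of "cbox 0 1"]]] r(1)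
      by (auto simp: image_subset_iff)
    then have "fx z integrable_on cbox 0 1" by (rule integrable_continuous)
    then have "blinfun_apply (integral (cbox 0 1) (fx z)) u = integral (cbox 0 1) (\<lambda>x. fx z x u)" for u
      by (rule blinfun_apply_integral)
    moreover have "fx z x (t *s u) = t * fx z x u" for x
      using r e by (simp add: fx_def Ds cdifferentiable_frechet(2)[OF s])
    ultimately show "blinfun_apply (integral (cbox 0 1) (fx z)) (t *s u) = t * blinfun_apply (integral (cbox 0 1) (fx z)) u"
      by simp
  qed
qed

section \<open>Twice differentiable functions\<close>

text \<open>The regularity on which the complex Hessian and its product rule rely. It is preserved by all
operations below through pointwise derivative rules alone.\<close>

definition twice_differentiable_on ::
  "'e::real_normed_vector set \<Rightarrow> ('e \<Rightarrow> 'f::real_normed_vector) \<Rightarrow> bool" where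
  "twice_differentiable_on S u \<longleftrightarrow>
     (\<forall>x\<in>S. u differentiable (at x) \<and> (\<forall>v. (\<lambda>x. frechet_derivative u (at x) v) differentiable (at x)))"

lemma differentiable_transform_open:
  assumes "f differentiable (at x)" "open S" "x \<in> S" "\<And>y. y \<in> S \<Longrightarrow> f y = g y"
  shows "g differentiable (at x)"
  using assms has_derivative_transform_within_open unfolding differentiable_def by blast

lemma twice_differentiable_onI:
  assumes "open S" "\<And>x. x \<in> S \<Longrightarrow> (u has_derivative D x) (at x)"
    and "\<And>x v. x \<in> S \<Longrightarrow> (\<lambda>x. D x v) differentiable (at x)"
  shows "twice_differentiable_on S u"
  unfolding twice_differentiable_on_def
proof (intro ballI conjI allI)
  fix x v assume x: "x \<in> S"
  show "u differentiable (at x)" using assms(2)[OF x] differentiableI by blast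
  show "(\<lambda>x. frechet_derivative u (at x) v) differentiable (at x)"
  proof (rule differentiable_transform_open[OF assms(3)[OF x] assms(1) x])
    fix y assume "y \<in> S"
    from frechet_derivative_at[OF assms(2)[OF this]]
    show "D y v = frechet_derivative u (at y) v" by simp
  qed
qed

lemma twice_differentiable_onD:
  assumes "twice_differentiable_on S u" "x \<in> S"
  shows "u differentiable (at x)"
    and "(u has_derivative frechet_derivative u (at x)) (at x)"
    and "(\<lambda>x. frechet_derivative u (at x) v) differentiable (at x)"
  using assms frechet_derivative_works unfolding twice_differentiable_on_def by blast+

lemma twice_differentiable_on_cong:
  assumes "open S" "twice_differentiable_on S u" "\<And>x. x \<in> S \<Longrightarrow> u x = w x"
  shows "twice_differentiable_on S w"
  by (rule twice_differentiable_onI[OF assms(1)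
        has_derivative_transform_within_open[OF twice_differentiable_onD(2)[OF assms(2)] assms(1)]])
     (auto intro: assms(3) twice_differentiable_onD(3)[OF assms(2)])

lemma smooth_imp_twice_differentiable:
  assumes "smooth_on S u"
  shows "twice_differentiable_on S u"
proof -
  have "Ck_on (Suc (Suc 0)) S u" using assms unfolding smooth_on_def by blast
  then show ?thesis unfolding twice_differentiable_on_def by simp
qed

lemma cdifferentiable_imp_twice_differentiable:
  assumes "open S" "\<And>z. z \<in> S \<Longrightarrow> cdifferentiable s z"
  shows "twice_differentiable_on S s"
  unfolding twice_differentiable_on_def
  using cdifferentiable_frechet(3)[OF assms(2)] cdifferentiable_frechet(3)[OF cdifferentiable_frechet_derivative[OF assms]] by blast

lemma twice_differentiable_on_const: "open S \<Longrightarrow> twice_differentiable_on S (\<lambda>_. c)"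
  by (rule twice_differentiable_onI[of _ _ "\<lambda>_ _. 0"]) auto

lemma bounded_linear_differentiable:
  assumes "bounded_linear L" "u differentiable (at x)"
  shows "(\<lambda>x. L (u x)) differentiable (at x)"
  using assms bounded_linear.has_derivative unfolding differentiable_def by blast

lemma twice_differentiable_on_linear:
  assumes "open S" "bounded_linear L" "twice_differentiable_on S u"
  shows "twice_differentiable_on S (\<lambda>x. L (u x))"
  by (rule twice_differentiable_onI[OF assms(1)
        bounded_linear.has_derivative[OF assms(2) twice_differentiable_onD(2)[OF assms(3)]]])
     (auto intro: bounded_linear_differentiable[OF assms(2) twice_differentiable_onD(3)[OF assms(3)]])

lemma twice_differentiable_on_add:
  assumes "open S" "twice_differentiable_on S u" "twice_differentiable_on S w"
  shows "twice_differentiable_on S (\<lambda>x. u x + w x)"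
  by (rule twice_differentiable_onI[OF assms(1) has_derivative_add[OF
        twice_differentiable_onD(2)[OF assms(2)] twice_differentiable_onD(2)[OF assms(3)]]])
     (auto intro!: differentiable_add twice_differentiable_onD(3)[OF assms(2)] twice_differentiable_onD(3)[OF assms(3)])

lemma twice_differentiable_on_mult:
  fixes u w :: "'e::real_normed_vector \<Rightarrow> 'f::real_normed_algebra"
  assumes "open S" "twice_differentiable_on S u" "twice_differentiable_on S w"
  shows "twice_differentiable_on S (\<lambda>x. u x * w x)"
  by (rule twice_differentiable_onI[OF assms(1) has_derivative_mult[OF
        twice_differentiable_onD(2)[OF assms(2)] twice_differentiable_onD(2)[OF assms(3)]]])
     (auto intro!: differentiable_add differentiable_mult twice_differentiable_onD[OF assms(2)]
        twice_differentiable_onD[OF assms(3)])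

lemma twice_differentiable_on_sum:
  assumes "open S" "\<And>i. i \<in> I \<Longrightarrow> twice_differentiable_on S (u i)"
  shows "twice_differentiable_on S (\<lambda>x. \<Sum>i\<in>I. u i x)"
  using assms
  by (induction I rule: infinite_finite_induct)
     (auto intro: twice_differentiable_on_const twice_differentiable_on_add)

lemma twice_differentiable_on_prod:
  fixes u :: "_ \<Rightarrow> 'e::real_normed_vector \<Rightarrow> 'f::{real_normed_algebra,comm_ring_1}"
  assumes "open S" "\<And>i. i \<in> I \<Longrightarrow> twice_differentiable_on S (u i)"
  shows "twice_differentiable_on S (\<lambda>x. \<Prod>i\<in>I. u i x)"
  using assms
  by (induction I rule: infinite_finite_induct)
     (auto intro: twice_differentiable_on_const twice_differentiable_on_mult)

lemma twice_differentiable_on_inverse: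
  fixes u :: "'e::real_normed_vector \<Rightarrow> 'f::real_normed_field"
  assumes "open S" "twice_differentiable_on S u" "\<And>x. x \<in> S \<Longrightarrow> u x \<noteq> 0"
  shows "twice_differentiable_on S (\<lambda>x. inverse (u x))"
  by (rule twice_differentiable_onI[OF assms(1) Deriv.has_derivative_inverse[OF
        assms(3) twice_differentiable_onD(2)[OF assms(2)]]])
     (assumption, assumption, intro differentiable_minus differentiable_mult differentiable_inverse
        assms(3) twice_differentiable_onD(1,3)[OF assms(2)])

lemma twice_differentiable_on_ln:
  fixes u :: "'e::real_normed_vector \<Rightarrow> real"
  assumes "open S" "twice_differentiable_on S u" "\<And>x. x \<in> S \<Longrightarrow> u x > 0"
  shows "twice_differentiable_on S (\<lambda>x. ln (u x))"
proof (rule twice_differentiable_onI[OF assms(1)])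
  fix x v assume x: "x \<in> S"
  show "((\<lambda>x. ln (u x)) has_derivative (\<lambda>v. frechet_derivative u (at x) v * inverse (u x))) (at x)"
    using has_derivative_ln[OF assms(3)[OF x] twice_differentiable_onD(2)[OF assms(2) x]]
    by (simp add: divide_inverse)
  show "(\<lambda>x. frechet_derivative u (at x) v * inverse (u x)) differentiable (at x)"
    using assms(3)[OF x] twice_differentiable_onD[OF assms(2) x]
    by (intro differentiable_mult differentiable_inverse) auto
qed

text \<open>By the chain rule the derivative of \<open>G \<circ> F\<close> in direction \<open>v\<close> is \<open>DG (F x) (DF x v)\<close>, in which \<open>x\<close>
enters twice. Expanding \<open>DF x v\<close> in an orthonormal basis separates the two and leaves a sum of
products of differentiable functions.\<close>

lemma twice_differentiable_on_compose:
  fixes F :: "'e::real_normed_vector \<Rightarrow> 'k::euclidean_space"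
  assumes S: "open S" and F: "twice_differentiable_on S F"
    and G: "twice_differentiable_on T G" and T: "\<And>x. x \<in> S \<Longrightarrow> F x \<in> T"
  shows "twice_differentiable_on S (\<lambda>x. G (F x))"
proof (rule twice_differentiable_onI[OF S])
  fix x v assume x: "x \<in> S"
  let ?D = "\<lambda>x v. \<Sum>b\<in>Basis. (frechet_derivative F (at x) v \<bullet> b) *\<^sub>R frechet_derivative G (at (F x)) b"
  have G': "(G has_derivative frechet_derivative G (at (F x))) (at (F x))"
    using twice_differentiable_onD(2)[OF G T[OF x]] .
  then have lin: "linear (frechet_derivative G (at (F x)))" by (rule has_derivative_linear)
  have expand: "frechet_derivative G (at (F x)) y = (\<Sum>b\<in>Basis. (y \<bullet> b) *\<^sub>R frechet_derivative G (at (F x)) b)" for y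
  proof -
    have "frechet_derivative G (at (F x)) (\<Sum>b\<in>Basis. (y \<bullet> b) *\<^sub>R b) =
        (\<Sum>b\<in>Basis. (y \<bullet> b) *\<^sub>R frechet_derivative G (at (F x)) b)"
      by (simp add: linear_sum[OF lin] linear_scale[OF lin])
    then show ?thesis by (simp add: euclidean_representation)
  qed
  show "((\<lambda>x. G (F x)) has_derivative ?D x) (at x)"
    using has_derivative_compose[OF twice_differentiable_onD(2)[OF F x] G']
    by (subst expand[symmetric])
  have "(\<lambda>x. (frechet_derivative F (at x) v \<bullet> b) *\<^sub>R frechet_derivative G (at (F x)) b) differentiable (at x)" for b
  proof (intro differentiable_scaleR)
    show "(\<lambda>x. frechet_derivative F (at x) v \<bullet> b) differentiable (at x)"
      by (rule bounded_linear_differentiable[OF bounded_linear_inner_left twice_differentiable_onD(3)[OF F x]])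
    show "(\<lambda>x. frechet_derivative G (at (F x)) b) differentiable (at x)"
      using differentiable_chain_at[OF twice_differentiable_onD(1)[OF F x] twice_differentiable_onD(3)[OF G T[OF x], of b]]
      by (simp add: o_def)
  qed
  then show "(\<lambda>x. ?D x v) differentiable (at x)"
    by (intro differentiable_sum) auto
qed

section \<open>Wirtinger derivatives and the complex Hessian\<close>

lemma wirtinger_transform:
  assumes "u differentiable (at z)" "open S" "z \<in> S" "\<And>x. x \<in> S \<Longrightarrow> u x = w x"
  shows "wirtinger a u z = wirtinger a w z" "wirtinger_bar a u z = wirtinger_bar a w z"
  using frechet_derivative_transform_within_open[OF assms]
  by (simp_all add: wirtinger_def wirtinger_bar_def)

lemma frechet_derivative_mult:
  fixes u w :: "'e::real_normed_vector \<Rightarrow> 'f::real_normed_algebra"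
  assumes "u differentiable (at z)" "w differentiable (at z)"
  shows "frechet_derivative (\<lambda>x. u x * w x) (at z) =
    (\<lambda>v. u z * frechet_derivative w (at z) v + frechet_derivative u (at z) v * w z)"
  by (rule frechet_derivative_at[symmetric, OF has_derivative_mult[OF assms[unfolded frechet_derivative_works]]])

lemma wirtinger_mult:
  assumes "u differentiable (at z)" "w differentiable (at z)"
  shows "wirtinger a (\<lambda>x. u x * w x) z = wirtinger a u z * w z + u z * wirtinger a w z"
    and "wirtinger_bar a (\<lambda>x. u x * w x) z = wirtinger_bar a u z * w z + u z * wirtinger_bar a w z"
  by (simp_all add: wirtinger_def wirtinger_bar_def frechet_derivative_mult[OF assms] field_simps)

lemma wirtinger_add:
  assumes "u differentiable (at z)" "w differentiable (at z)"
  shows "wirtinger a (\<lambda>x. u x + w x) z = wirtinger a u z + wirtinger a w z"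
    and "wirtinger_bar a (\<lambda>x. u x + w x) z = wirtinger_bar a u z + wirtinger_bar a w z"
proof -
  have "frechet_derivative (\<lambda>x. u x + w x) (at z) =
    (\<lambda>v. frechet_derivative u (at z) v + frechet_derivative w (at z) v)"
    by (rule frechet_derivative_at[symmetric, OF has_derivative_add[OF assms[unfolded frechet_derivative_works]]])
  then show "wirtinger a (\<lambda>x. u x + w x) z = wirtinger a u z + wirtinger a w z"
    and "wirtinger_bar a (\<lambda>x. u x + w x) z = wirtinger_bar a u z + wirtinger_bar a w z"
    by (simp_all add: wirtinger_def wirtinger_bar_def field_simps)
qed

lemma wirtinger_cnj:
  assumes "u differentiable (at z)"
  shows "wirtinger a (\<lambda>x. cnj (u x)) z = cnj (wirtinger_bar a u z)"
    and "wirtinger_bar a (\<lambda>x. cnj (u x)) z = cnj (wirtinger a u z)"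
proof -
  have "frechet_derivative (\<lambda>x. cnj (u x)) (at z) = (\<lambda>v. cnj (frechet_derivative u (at z) v))"
    by (rule frechet_derivative_at[symmetric, OF bounded_linear.has_derivative[OF bounded_linear_cnj
          assms[unfolded frechet_derivative_works]]])
  then show "wirtinger a (\<lambda>x. cnj (u x)) z = cnj (wirtinger_bar a u z)"
    and "wirtinger_bar a (\<lambda>x. cnj (u x)) z = cnj (wirtinger a u z)"
    by (simp_all add: wirtinger_def wirtinger_bar_def)
qed

lemma differentiable_cnj:
  "u differentiable (at z) \<Longrightarrow> (\<lambda>x. cnj (u x)) differentiable (at z)"
  by (rule bounded_linear_differentiable[OF bounded_linear_cnj])

lemma wirtinger_exp:
  assumes "u differentiable (at z)"
  shows "wirtinger a (\<lambda>x. exp (u x)) z = exp (u z) * wirtinger a u z"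
    and "wirtinger_bar a (\<lambda>x. exp (u x)) z = exp (u z) * wirtinger_bar a u z"
    and "(\<lambda>x. exp (u x)) differentiable (at z)"
proof -
  have "((\<lambda>x. exp (u x)) has_derivative (\<lambda>v. exp (u z) * frechet_derivative u (at z) v)) (at z)"
    using has_derivative_compose[OF assms[unfolded frechet_derivative_works]
        DERIV_exp[unfolded has_field_derivative_def]] .
  then have "frechet_derivative (\<lambda>x. exp (u x)) (at z) = (\<lambda>v. exp (u z) * frechet_derivative u (at z) v)"
    and "(\<lambda>x. exp (u x)) differentiable (at z)"
    by (rule frechet_derivative_at[symmetric], rule differentiableI)
  then show "wirtinger a (\<lambda>x. exp (u x)) z = exp (u z) * wirtinger a u z"
    and "wirtinger_bar a (\<lambda>x. exp (u x)) z = exp (u z) * wirtinger_bar a u z"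
    and "(\<lambda>x. exp (u x)) differentiable (at z)"
    by (simp_all add: wirtinger_def wirtinger_bar_def field_simps)
qed

text \<open>The direction \<open>axis a \<i>\<close> is \<open>\<i>\<close> times \<open>axis a 1\<close>, so for a complex linear derivative the two terms
of \<open>\<partial>/\<partial>\<zeta>\<^sup>a\<close> agree and those of its conjugate cancel.\<close>

lemma wirtinger_holomorphic:
  fixes s :: "complex^'d::finite \<Rightarrow> complex"
  assumes "cdifferentiable s z"
  shows "wirtinger a s z = frechet_derivative s (at z) (axis a 1)"
    and "wirtinger_bar a s z = 0"
proof -
  have "axis a \<i> = \<i> *s (axis a 1 :: complex^'d)" by (simp add: vec_eq_iff axis_def)
  then have "frechet_derivative s (at z) (axis a \<i>) = \<i> * frechet_derivative s (at z) (axis a 1)"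
    using cdifferentiable_frechet(2)[OF assms] by metis
  then show "wirtinger a s z = frechet_derivative s (at z) (axis a 1)"
    and "wirtinger_bar a s z = 0"
    by (simp_all add: wirtinger_def wirtinger_bar_def flip: mult.assoc)
qed

lemma complex_hessian_add:
  assumes V: "open V" "z \<in> V" and u: "twice_differentiable_on V u" and w: "twice_differentiable_on V w"
  shows "complex_hessian (\<lambda>x. u x + w x) z = complex_hessian u z + complex_hessian w z"
proof -
  have d: "wirtinger_bar b u differentiable (at z)" if "twice_differentiable_on V u" for b u
    unfolding wirtinger_bar_def
    by (intro differentiable_divide differentiable_add differentiable_mult twice_differentiable_onD(3)[OF that V(2)]) auto
  have "wirtinger a (wirtinger_bar b (\<lambda>x. u x + w x)) z =
    wirtinger a (wirtinger_bar b u) z + wirtinger a (wirtinger_bar b w) z" for a b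
  proof -
    have "wirtinger a (\<lambda>x. wirtinger_bar b u x + wirtinger_bar b w x) z
       = wirtinger a (wirtinger_bar b (\<lambda>x. u x + w x)) z"
      by (rule wirtinger_transform[OF _ V])
         (auto intro!: differentiable_add d u w simp: wirtinger_add twice_differentiable_onD(1)[OF u] twice_differentiable_onD(1)[OF w])
    then show ?thesis by (simp add: wirtinger_add d u w)
  qed
  then show ?thesis by (simp add: complex_hessian_def vec_eq_iff)
qed

text \<open>The identity that drives the whole argument: \<open>\<partial>bar\<^sub>b\<close> does not see \<open>s\<close>, and \<open>\<partial>\<^sub>a\<close> does not see
\<open>cnj s\<close> and \<open>cnj (\<partial>\<^sub>b s)\<close>. The reality of \<open>\<psi>\<close> turns \<open>\<partial>bar\<^sub>b \<psi>\<close> into \<open>cnj (\<partial>\<^sub>b \<psi>)\<close>, which makes the two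
factors of the leading term conjugate to each other.\<close>

lemma hessian_weighted_norm:
  fixes s :: "complex^'d::finite \<Rightarrow> complex" and \<psi> :: "complex^'d \<Rightarrow> real"
  assumes V: "open V" "z \<in> V"
    and s: "\<And>x. x \<in> V \<Longrightarrow> cdifferentiable s x"
    and psi: "twice_differentiable_on V (\<lambda>x. complex_of_real (\<psi> x))"
    and u: "\<And>x. x \<in> V \<Longrightarrow> u x = (cmod (s x))\<^sup>2 * exp (\<psi> x)"
  defines "\<theta> \<equiv> \<lambda>a. wirtinger a s z + s z * wirtinger a (\<lambda>x. complex_of_real (\<psi> x)) z"
  shows "complex_hessian (\<lambda>x. complex_of_real (u x)) z $ a $ b =
    of_real (exp (\<psi> z)) * \<theta> a * cnj (\<theta> b) + of_real (u z) * complex_hessian (\<lambda>x. complex_of_real (\<psi> x)) z $ a $ b"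
proof -
  let ?p = "\<lambda>x. complex_of_real (\<psi> x)" and ?u = "\<lambda>x. complex_of_real (u x)"
  let ?E = "\<lambda>x. exp (?p x)"
  define P where "P x = frechet_derivative s (at x) (axis b 1)" for x
  define q where "q = wirtinger_bar b ?p"
  have P: "cdifferentiable P z" unfolding P_def using cdifferentiable_frechet_derivative[OF V(1) s V(2)] by blast
  have q: "q differentiable (at z)"
    unfolding q_def wirtinger_bar_def
    by (intro differentiable_divide differentiable_add differentiable_mult twice_differentiable_onD(3)[OF psi V(2)]) auto
  have dp: "?p differentiable (at x)" if "x \<in> V" for x
    using twice_differentiable_onD(1)[OF psi that] .
  note dE = wirtinger_exp[OF dp]
  have ds: "s differentiable (at x)" if "x \<in> V" for x using cdifferentiable_frechet(3)[OF s[OF that]] .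
  have du: "(\<lambda>x. s x * (cnj (s x) * ?E x)) differentiable (at x)" if "x \<in> V" for x
    by (intro differentiable_mult differentiable_cnj ds dE that)
  have ueq: "s x * (cnj (s x) * ?E x) = ?u x" if "x \<in> V" for x
    by (simp add: u[OF that] complex_norm_square mult.assoc exp_of_real del: of_real_power)
  \<comment> \<open>The inner derivative must be known on all of \<open>V\<close>, since it is differentiated once more.\<close>
  have first: "(s x) * ((cnj (P x) + cnj (s x) * q x) * ?E x) = wirtinger_bar b ?u x" if x: "x \<in> V" for x
  proof -
    have "wirtinger_bar b ?u x = wirtinger_bar b (\<lambda>x. s x * (cnj (s x) * ?E x)) x"
      using wirtinger_transform(2)[OF du[OF x] V(1) x ueq] by simp
    also have "\<dots> = s x * (cnj (P x) * ?E x + cnj (s x) * (?E x * q x))"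
      by (simp add: wirtinger_mult wirtinger_cnj differentiable_mult differentiable_cnj ds dE x
          wirtinger_holomorphic[OF s[OF x]] P_def q_def)
    finally show ?thesis by (simp add: algebra_simps)
  qed
  have dc: "(\<lambda>x. cnj (P x) + cnj (s x) * q x) differentiable (at z)"
    by (intro differentiable_add differentiable_mult differentiable_cnj cdifferentiable_frechet(3)[OF P] ds q V)
  \<comment> \<open>Here \<open>P = \<partial>\<^sub>b s\<close> is holomorphic, so that \<open>\<partial>\<^sub>a (cnj P)\<close> vanishes.\<close>
  have "wirtinger a (wirtinger_bar b ?u) z = wirtinger a (\<lambda>x. s x * ((cnj (P x) + cnj (s x) * q x) * ?E x)) z"
    by (rule wirtinger_transform(1)[symmetric, OF _ V first])
       (intro differentiable_mult dc ds dE V)+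
  also have "\<dots> = wirtinger a s z * ((cnj (P z) + cnj (s z) * q z) * ?E z) +
     s z * (cnj (s z) * wirtinger a q z * ?E z + (cnj (P z) + cnj (s z) * q z) * (?E z * wirtinger a ?p z))"
    by (simp add: wirtinger_mult wirtinger_add wirtinger_cnj differentiable_mult differentiable_cnj ds dE dc q V
          cdifferentiable_frechet(3)[OF P] wirtinger_holomorphic(2)[OF P] wirtinger_holomorphic(2)[OF s])
  also have "\<dots> = ?E z * \<theta> a * (cnj (P z) + cnj (s z) * q z) + (s z * (cnj (s z) * ?E z)) * wirtinger a q z"
    by (simp add: \<theta>_def algebra_simps)
  also have "cnj (P z) + cnj (s z) * q z = cnj (\<theta> b)"
  proof -
    have "q z = cnj (wirtinger b ?p z)"
      using wirtinger_cnj(2)[OF dp[OF V(2)], of b] by (simp add: q_def)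
    then show ?thesis by (simp add: \<theta>_def P_def wirtinger_holomorphic[OF s] V)
  qed
  finally show ?thesis
    using ueq[OF V(2)] by (simp add: complex_hessian_def q_def exp_of_real)
qed

text \<open>The Hermitian form of \<open>\<theta>\<^sub>a cnj \<theta>\<^sub>b\<close> at \<open>\<xi>\<close> is the square of \<open>|\<Sum> \<theta>\<^sub>a \<xi>\<^sup>a|\<close>.\<close>

lemma semi_positive_rank_one:
  assumes "c \<ge> 0" "\<And>a b. A $ a $ b = of_real c * \<theta> a * cnj (\<theta> b)"
  shows "semi_positive A"
  unfolding semi_positive_def
proof
  fix \<xi> :: "complex^'a"
  define t where "t = (\<Sum>a\<in>UNIV. \<theta> a * \<xi> $ a)"
  have "(\<Sum>a\<in>UNIV. \<Sum>b\<in>UNIV. A$a$b * \<xi>$a * cnj (\<xi>$b)) = of_real c * (t * cnj t)"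
    unfolding t_def cnj_sum sum_product by (simp add: assms(2) sum_distrib_left algebra_simps)
  also have "\<dots> = of_real (c * (cmod t)\<^sup>2)"
    by (simp add: complex_norm_square[symmetric])
  finally show "(\<Sum>a\<in>UNIV. \<Sum>b\<in>UNIV. A$a$b * \<xi>$a * cnj (\<xi>$b)) \<in> \<real>\<^sub>\<ge>\<^sub>0"
    using assms(1) by (simp only: nonneg_Reals_of_real_iff) simp
qed

lemma semi_positive_weighted_norm:
  fixes s :: "complex^'d::finite \<Rightarrow> complex" and H H1 :: "complex^'d \<Rightarrow> real"
  assumes V: "open V" "z \<in> V"
    and s: "\<And>x. x \<in> V \<Longrightarrow> cdifferentiable s x"
    and H: "twice_differentiable_on V H" "\<And>x. x \<in> V \<Longrightarrow> H x > 0"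
    and H1: "twice_differentiable_on V H1" "\<And>x. x \<in> V \<Longrightarrow> H1 x > 0"
    and u: "\<And>x. x \<in> V \<Longrightarrow> u x = (cmod (s x))\<^sup>2 / (H1 x * H x)"
  shows "semi_positive (complex_hessian (\<lambda>x. complex_of_real (u x)) z -
    u z *\<^sub>R (complex_hessian (\<lambda>x. complex_of_real (ln (inverse (H x)))) z
          + complex_hessian (\<lambda>x. complex_of_real (ln (inverse (H1 x)))) z))"
proof -
  define \<psi> where "\<psi> x = ln (inverse (H x)) + ln (inverse (H1 x))" for x
  have l: "twice_differentiable_on V (\<lambda>x. complex_of_real (ln (inverse (H x))))"
    if H: "twice_differentiable_on V H" "\<And>x. x \<in> V \<Longrightarrow> H x > 0" for H
    by (intro twice_differentiable_on_linear[OF V(1) bounded_linear_of_real]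
         twice_differentiable_on_ln twice_differentiable_on_inverse V H)
       (use H in force)+
  have psi: "twice_differentiable_on V (\<lambda>x. complex_of_real (\<psi> x))"
    unfolding \<psi>_def of_real_add
    by (intro twice_differentiable_on_add V l H H1)
  have hp: "complex_hessian (\<lambda>x. complex_of_real (\<psi> x)) z = complex_hessian (\<lambda>x. complex_of_real (ln (inverse (H x)))) z
          + complex_hessian (\<lambda>x. complex_of_real (ln (inverse (H1 x)))) z"
    unfolding \<psi>_def of_real_add by (rule complex_hessian_add[OF V l[OF H] l[OF H1]])
  have u': "u x = (cmod (s x))\<^sup>2 * exp (\<psi> x)" if x: "x \<in> V" for x
    using u[OF x] H(2)[OF x] H1(2)[OF x] by (simp add: \<psi>_def exp_add exp_ln field_simps)
  show ?thesis
    unfolding hp[symmetric]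
    by (rule semi_positive_rank_one[of "exp (\<psi> z)" _
          "\<lambda>a. wirtinger a s z + s z * wirtinger a (\<lambda>x. complex_of_real (\<psi> x)) z"])
       (simp_all add: hessian_weighted_norm[OF V s psi u'] scaleR_conv_of_real[where 'a=complex])
qed

section \<open>Hermitian forms and their duals\<close>

text \<open>The complex bilinear pairing of vectors and covectors, not the Hermitian inner product: it keeps
conjugations explicit and is invariant under holomorphic changes of coordinates.\<close>

definition pairing :: "complex^'k::finite \<Rightarrow> complex^'k \<Rightarrow> complex" where
  "pairing x y = (\<Sum>i\<in>UNIV. x $ i * y $ i)"

definition cnj_vec :: "complex^'k \<Rightarrow> complex^'k" where
  "cnj_vec v = (\<chi> i. cnj (v $ i))"

definition cnj_mat :: "complex^'k^'l \<Rightarrow> complex^'k^'l" where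
  "cnj_mat A = (\<chi> i j. cnj (A $ i $ j))"

lemma cnj_vec_cnj_vec [simp]: "cnj_vec (cnj_vec v) = v"
  by (simp add: cnj_vec_def vec_eq_iff)

lemma cnj_vec_mult: "cnj_vec (A *v v) = cnj_mat A *v cnj_vec v"
  by (simp add: cnj_vec_def cnj_mat_def vec_eq_iff matrix_vector_mult_def)

lemma pairing_cnj_vec: "pairing (cnj_vec x) (cnj_vec y) = cnj (pairing x y)"
  by (simp add: pairing_def cnj_vec_def)

lemma pairing_scale: "pairing (t *s x) y = t * pairing x y" "pairing x (t *s y) = t * pairing x y"
  by (simp_all add: pairing_def sum_distrib_left mult_ac)

lemma pairing_transpose: "pairing x (A *v y) = pairing (transpose A *v x) y"
proof -
  have "pairing x (A *v y) = (\<Sum>i\<in>UNIV. \<Sum>j\<in>UNIV. x $ i * A $ i $ j * y $ j)"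
    by (simp add: pairing_def matrix_vector_mult_def sum_distrib_left mult.assoc)
  also have "\<dots> = (\<Sum>j\<in>UNIV. \<Sum>i\<in>UNIV. x $ i * A $ i $ j * y $ j)"
    by (rule sum.swap)
  also have "\<dots> = pairing (transpose A *v x) y"
    unfolding pairing_def matrix_vector_mult_def transpose_def
    by (simp add: sum_distrib_left sum_distrib_right mult_ac)
  finally show ?thesis .
qed

lemma herm_pairing: "herm A v = Re (pairing v (A *v cnj_vec v))"
  unfolding herm_def pairing_def cnj_vec_def matrix_vector_mult_def
  by (simp add: sum_distrib_left mult_ac)

lemma herm_scale: "herm A (t *s v) = (cmod t)\<^sup>2 * herm A v"
proof -
  have "cnj_vec (t *s v) = cnj t *s cnj_vec v" by (simp add: cnj_vec_def vec_eq_iff)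
  then have "herm A (t *s v) = Re ((t * cnj t) * pairing v (A *v cnj_vec v))"
    by (simp only: herm_pairing pairing_scale vector_scalar_commute mult_ac)
  also have "t * cnj t = of_real ((cmod t)\<^sup>2)" by (rule complex_norm_square[symmetric])
  finally show ?thesis by (simp only: herm_pairing scaleR_conv_of_real[symmetric] scaleR_complex.sel)
qed

lemma herm_change_basis:
  assumes "A = transpose J ** A' ** cnj_mat J"
  shows "herm A v = herm A' (J *v v)"
proof -
  have "A *v cnj_vec v = transpose J *v (A' *v cnj_vec (J *v v))"
    by (simp only: assms cnj_vec_mult matrix_vector_mul_assoc matrix_mul_assoc)
  then show ?thesis by (simp only: herm_pairing pairing_transpose transpose_transpose)
qed

text \<open>A vector in the kernel of \<open>A\<close> is the conjugate of a vector on which the form vanishes.\<close>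

lemma pos_def_invertible:
  assumes "\<And>v. v \<noteq> 0 \<Longrightarrow> herm A v > 0"
  shows "invertible A"
proof -
  have "x = 0" if "A *v x = 0" for x
  proof (rule ccontr)
    assume "x \<noteq> 0"
    then have "cnj_vec x \<noteq> 0" by (simp add: cnj_vec_def vec_eq_iff)
    from assms[OF this] that show False by (simp add: herm_pairing pairing_def)
  qed
  then show ?thesis by (simp add: invertible_left_inverse matrix_left_invertible_ker)
qed

lemma matrix_inv_mult:
  fixes A :: "complex^'k::finite^'k"
  assumes "invertible A"
  shows "A ** matrix_inv A = mat 1" "matrix_inv A ** A = mat 1"
  using someI_ex[OF assms[unfolded invertible_def]] unfolding matrix_inv_def by auto

text \<open>The covector \<open>X = A (cnj Y)\<close> is the metric dual of the vector \<open>Y\<close>, and the dual form is made so that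
this correspondence preserves lengths. Positivity and invariance of the dual metric are thereby
inherited from the metric, without manipulating inverse matrices.\<close>

lemma herm_dual:
  fixes A :: "complex^'k::finite^'k"
  assumes "invertible A" "A *v cnj_vec Y = X"
  shows "herm (transpose (matrix_inv A)) X = herm A Y"
proof -
  have inv: "matrix_inv A *v X = cnj_vec Y"
    by (simp add: assms(2)[symmetric] matrix_vector_mul_assoc matrix_inv_mult[OF assms(1)])
  have "pairing X (transpose (matrix_inv A) *v cnj_vec X) = pairing (cnj_vec Y) (cnj_vec (A *v cnj_vec Y))"
    by (simp only: pairing_transpose transpose_transpose inv assms(2))
  also have "\<dots> = cnj (pairing Y (A *v cnj_vec Y))" by (rule pairing_cnj_vec)
  finally show ?thesis by (simp add: herm_pairing)
qed

lemma dual_representative: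
  fixes A :: "complex^'k::finite^'k"
  assumes "invertible A"
  obtains Y where "A *v cnj_vec Y = X"
  using that[of "cnj_vec (matrix_inv A *v X)"]
  by (simp add: matrix_vector_mul_assoc matrix_inv_mult[OF assms])

lemma herm_dual_pos:
  assumes "\<And>v. v \<noteq> 0 \<Longrightarrow> herm A v > 0" "X \<noteq> 0"
  shows "herm (transpose (matrix_inv A)) X > 0"
proof -
  obtain Y where Y: "A *v cnj_vec Y = X"
    using dual_representative[OF pos_def_invertible[OF assms(1)]] by blast
  moreover have "cnj_vec 0 = (0 :: complex^'a)" by (simp add: cnj_vec_def vec_eq_iff)
  ultimately have "Y \<noteq> 0" using assms(2) by auto
  then show ?thesis using herm_dual[OF pos_def_invertible Y] assms(1) by simp
qed

text \<open>If \<open>Y\<close> represents \<open>X\<close> with respect to \<open>A\<close>, then \<open>J Y\<close> represents \<open>X'\<close> with respect to \<open>A'\<close>; so the claim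
follows from the invariance of the length of vectors.\<close>

lemma herm_dual_change_basis:
  fixes A A' J :: "complex^'k::finite^'k"
  assumes A: "A = transpose J ** A' ** cnj_mat J"
    and inv: "invertible A" "invertible A'" "invertible J"
    and X: "X = transpose J *v X'"
  shows "herm (transpose (matrix_inv A)) X = herm (transpose (matrix_inv A')) X'"
proof -
  obtain Y where Y: "A *v cnj_vec Y = X" using dual_representative[OF inv(1)] .
  have "transpose J *v (A' *v cnj_vec (J *v Y)) = transpose J *v X'"
    unfolding Y[symmetric] X[symmetric] by (simp only: A cnj_vec_mult matrix_vector_mul_assoc matrix_mul_assoc)
  moreover have "invertible (transpose J)" using inv(3) by (simp add: invertible_det_nz det_transpose)
  ultimately have "A' *v cnj_vec (J *v Y) = X'"
    using inj_matrix_vector_mult[THEN injD] by blast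
  from herm_dual[OF inv(2) this] show ?thesis
    using herm_dual[OF inv(1) Y] herm_change_basis[OF A, of Y] by simp
qed

lemma matrix_mult_axis: "(A *v axis k 1) $ i = (A $ i $ k :: complex)"
  by (simp add: matrix_vector_mult_def axis_def if_distrib cong: if_cong)

text \<open>An expression for the inverse that is visibly built from sums, products and one division, which
is how the inverse metric is seen to be twice differentiable.\<close>

lemma matrix_inv_cramer:
  fixes A :: "complex^'k::finite^'k"
  assumes "invertible A"
  shows "matrix_inv A $ k $ l = det (\<chi> i j. if j = k then axis l 1 $ i else A $ i $ j) / det A"
proof -
  have "A *v (matrix_inv A *v axis l 1) = axis l 1"
    by (simp add: matrix_vector_mul_assoc matrix_inv_mult[OF assms])
  then have "matrix_inv A *v axis l 1 = (\<chi> k. det (\<chi> i j. if j = k then axis l 1 $ i else A $ i $ j) / det A)"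
    using cramer assms invertible_det_nz by blast
  moreover have "(matrix_inv A *v axis l 1) $ k = matrix_inv A $ k $ l"
    by (rule matrix_mult_axis)
  ultimately show ?thesis by simp
qed

lemma twice_differentiable_on_det:
  fixes A :: "'e::real_normed_vector \<Rightarrow> complex^'k::finite^'k"
  assumes S: "open S" and A: "\<And>i j. twice_differentiable_on S (\<lambda>x. A x $ i $ j)"
  shows "twice_differentiable_on S (\<lambda>x. det (A x))"
  unfolding det_def
  by (intro twice_differentiable_on_sum twice_differentiable_on_mult twice_differentiable_on_prod
        twice_differentiable_on_const S A)

lemma twice_differentiable_on_matrix_inv:
  fixes A :: "'e::real_normed_vector \<Rightarrow> complex^'k::finite^'k"
  assumes S: "open S" and A: "\<And>i j. twice_differentiable_on S (\<lambda>x. A x $ i $ j)"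
    and inv: "\<And>x. x \<in> S \<Longrightarrow> invertible (A x)"
  shows "twice_differentiable_on S (\<lambda>x. matrix_inv (A x) $ k $ l)"
proof -
  \<comment> \<open>The entries of the matrix in Cramer's rule are constants or entries of \<open>A x\<close>.\<close>
  have "twice_differentiable_on S (\<lambda>x. (\<chi> i j. if j = k then axis l 1 $ i else A x $ i $ j) $ i $ j)" for i j
    using twice_differentiable_on_const[OF S] A by (cases "j = k") auto
  then have "twice_differentiable_on S
     (\<lambda>x. det (\<chi> i j. if j = k then axis l 1 $ i else A x $ i $ j) * inverse (det (A x)))"
    using inv
    by (intro twice_differentiable_on_mult twice_differentiable_on_inverse twice_differentiable_on_det S A)
       (auto simp: invertible_det_nz)
  then show ?thesis
    by (rule twice_differentiable_on_cong[OF S]) (simp add: matrix_inv_cramer[OF inv] divide_inverse)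
qed

lemma twice_differentiable_on_herm:
  fixes A :: "'e::real_normed_vector \<Rightarrow> complex^'k::finite^'k"
  assumes S: "open S" and A: "\<And>i j. twice_differentiable_on S (\<lambda>x. A x $ i $ j)"
    and v: "\<And>i. twice_differentiable_on S (\<lambda>x. v x $ i)"
  shows "twice_differentiable_on S (\<lambda>x. herm (A x) (v x))"
  unfolding herm_def
  by (intro twice_differentiable_on_linear[OF S bounded_linear_Re] twice_differentiable_on_sum
        twice_differentiable_on_mult twice_differentiable_on_linear[OF S bounded_linear_cnj] S A v)

section \<open>Jacobians\<close>

lemma complex_jacobian_component:
  assumes "cdifferentiable (\<lambda>z. F z $ i) z"
  shows "complex_jacobian F z $ i $ a = frechet_derivative (\<lambda>z. F z $ i) (at z) (axis a 1)"
proof -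
  have "((\<lambda>t. F (z + t *s axis a 1) $ i) has_field_derivative
      frechet_derivative (\<lambda>z. F z $ i) (at (z + 0 *s axis a 1)) (axis a 1)) (at 0)"
    using cdifferentiable_line[of "\<lambda>z. F z $ i" z 0] assms by simp
  from DERIV_imp_deriv[OF this] show ?thesis by (simp add: complex_jacobian_def)
qed

lemma complex_jacobian_unique:
  assumes "(F has_derivative (\<lambda>v. A *v v)) (at z)"
  shows "complex_jacobian F z = A"
proof -
  have "hol_on {z} F" using assms by (auto simp: hol_on_def)
  then have c: "cdifferentiable (\<lambda>z. F z $ i) z" for i by (simp add: hol_on_components)
  have "frechet_derivative (\<lambda>z. F z $ i) (at z) = (\<lambda>v. (A *v v) $ i)" for i
    using frechet_derivative_at[OF bounded_linear.has_derivative[OF bounded_linear_vec_nth assms]] by simp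
  then show ?thesis
    by (simp add: vec_eq_iff complex_jacobian_component[OF c] matrix_mult_axis)
qed

lemma hol_on_has_jacobian:
  assumes "hol_on S F" "z \<in> S"
  shows "(F has_derivative (\<lambda>v. complex_jacobian F z *v v)) (at z)"
proof -
  obtain A where A: "(F has_derivative (\<lambda>v. A *v v)) (at z)"
    using assms unfolding hol_on_def by blast
  then show ?thesis by (simp only: complex_jacobian_unique[OF A])
qed

lemma complex_jacobian_chain:
  assumes "(F has_derivative (\<lambda>v. A *v v)) (at z)" "(G has_derivative (\<lambda>v. B *v v)) (at (F z))"
    and "open S" "z \<in> S" "\<And>x. x \<in> S \<Longrightarrow> G (F x) = K x"
  shows "complex_jacobian K z = B ** A"
proof (rule complex_jacobian_unique)
  have "((\<lambda>x. G (F x)) has_derivative (\<lambda>v. (B ** A) *v v)) (at z)"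
    using has_derivative_compose[OF assms(1,2)] by (simp add: matrix_vector_mul_assoc)
  then show "(K has_derivative (\<lambda>v. (B ** A) *v v)) (at z)"
    by (rule has_derivative_transform_within_open[OF _ assms(3-5)])
qed

section \<open>Charts and changes of coordinates\<close>

lemma chart_inv_image:
  assumes "z \<in> snd c ` U" "U \<subseteq> fst c"
  shows "chart_inv c z \<in> fst c" "snd c (chart_inv c z) = z"
  using assms unfolding chart_inv_def by (auto intro: inv_into_into f_inv_into_f)

lemma openin_chart:
  "complex_manifold M \<Longrightarrow> c \<in> charts M \<Longrightarrow> openin (mtop M) (fst c)"
  unfolding complex_manifold_def by blast

lemma chart_homeomorphic:
  assumes "complex_manifold M" "c \<in> charts M"
  shows "homeomorphic_map (subtopology (mtop M) (fst c)) (top_of_set (snd c ` fst c)) (snd c)"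
    and "open (snd c ` fst c)"
  using assms unfolding complex_manifold_def by blast+

lemma chart_inj:
  assumes "complex_manifold M" "c \<in> charts M"
  shows "inj_on (snd c) (fst c)"
  using homeomorphic_imp_injective_map[OF chart_homeomorphic(1)[OF assms]]
    openin_subset[OF openin_chart[OF assms]]
  by (simp add: Int_absorb1)

lemma chart_inv_chart:
  assumes "complex_manifold M" "c \<in> charts M" "p \<in> fst c"
  shows "chart_inv c (snd c p) = p"
  using chart_inj[OF assms(1,2)] assms(3) unfolding chart_inv_def by simp

lemma open_chart_image:
  assumes "complex_manifold M" "c \<in> charts M" "openin (mtop M) U"
  shows "open (snd c ` (fst c \<inter> U))"
proof -
  note h = chart_homeomorphic[OF assms(1,2)]
  have "openin (subtopology (mtop M) (fst c)) (fst c \<inter> U)"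
    using assms(3) by (simp add: openin_subtopology_Int2)
  then have "openin (top_of_set (snd c ` fst c)) (snd c ` (fst c \<inter> U))"
    using homeomorphic_imp_open_map[OF h(1)] unfolding open_map_def by blast
  then show ?thesis using h(2) openin_open_trans by blast
qed

lemma charts_at_charts: "c \<in> charts_at M p \<longleftrightarrow> c \<in> charts M \<and> p \<in> fst c"
  by (simp add: charts_at_def)

lemma chart_change_derivative:
  assumes M: "complex_manifold M" and c: "c \<in> charts_at M p" "c' \<in> charts_at M p"
  shows "(snd c' \<circ> chart_inv c has_derivative (\<lambda>v. chart_change c c' p *v v)) (at (snd c p))"
  unfolding chart_change_def
proof (rule hol_on_has_jacobian)
  show "hol_on (snd c ` (fst c \<inter> fst c')) (snd c' \<circ> chart_inv c)"
    using M c unfolding complex_manifold_def charts_at_def by blast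
qed (use c in \<open>auto simp: charts_at_def\<close>)

text \<open>The cocycle condition, which is the chain rule for the composition of two coordinate changes. It
makes tangent and cotangent vectors with prescribed components in one chart exist.\<close>

lemma chart_change_chain:
  assumes M: "complex_manifold M"
    and c: "c \<in> charts_at M p" "c' \<in> charts_at M p" "c'' \<in> charts_at M p"
  shows "chart_change c' c'' p ** chart_change c c' p = chart_change c c'' p"
proof -
  have "(snd c'' \<circ> chart_inv c' has_derivative (\<lambda>v. chart_change c' c'' p *v v)) (at ((snd c' \<circ> chart_inv c) (snd c p)))"
    using chart_change_derivative[OF M c(2,3)] c chart_inv_chart[OF M, of c p] by (simp add: charts_at_charts)
  from complex_jacobian_chain[OF chart_change_derivative[OF M c(1,2)] this open_chart_image[OF M]]
  have "complex_jacobian (snd c'' \<circ> chart_inv c) (snd c p) = chart_change c' c'' p ** chart_change c c' p"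
  proof this
    show "openin (mtop M) (fst c')" "c \<in> charts M" using c openin_chart[OF M] by (auto simp: charts_at_charts)
    show "snd c p \<in> snd c ` (fst c \<inter> fst c')" using c by (auto simp: charts_at_charts)
    fix x assume "x \<in> snd c ` (fst c \<inter> fst c')"
    then show "(snd c'' \<circ> chart_inv c') ((snd c' \<circ> chart_inv c) x) = (snd c'' \<circ> chart_inv c) x"
      using c chart_inv_chart[OF M, of c] chart_inv_chart[OF M, of c'] by (auto simp: charts_at_charts)
  qed
  then show ?thesis unfolding chart_change_def[of c c''] by simp
qed

lemma chart_change_self:
  assumes M: "complex_manifold M" and c: "c \<in> charts_at M p"
  shows "chart_change c c p = mat 1"
  unfolding chart_change_def
proof (rule complex_jacobian_unique)
  have "((\<lambda>z. z) has_derivative (\<lambda>v. mat 1 *v v)) (at (snd c p))" by simp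
  then show "(snd c \<circ> chart_inv c has_derivative (*v) (mat 1)) (at (snd c p))"
  proof (rule has_derivative_transform_within_open)
    show "open (snd c ` (fst c \<inter> fst c))"
      using c by (intro open_chart_image[OF M] openin_chart[OF M]) (auto simp: charts_at_charts)
  qed (use c chart_inv_image[of _ c "fst c"] in \<open>auto simp: charts_at_charts\<close>)
qed

lemma chart_change_invertible:
  assumes "complex_manifold M" "c \<in> charts_at M p" "c' \<in> charts_at M p"
  shows "invertible (chart_change c c' p)"
  unfolding invertible_left_inverse
  using chart_change_chain[OF assms(1,2,3,2)] chart_change_self[OF assms(1,2)] by metis

abbreviation map_jacobian ::
  "('a \<Rightarrow> 'b) \<Rightarrow> ('a, 'm::finite) chart \<Rightarrow> ('b, 'n::finite) chart \<Rightarrow> 'a \<Rightarrow> complex^'m^'n" where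
  "map_jacobian f c d p \<equiv> complex_jacobian (snd d \<circ> f \<circ> chart_inv c) (snd c p)"

lemma openin_preimage_chart:
  assumes M: "complex_manifold M" and N: "complex_manifold N" and f: "holomorphic_map M N f"
    and "c \<in> charts M" "d \<in> charts N"
  shows "open (snd c ` (fst c \<inter> f -` fst d))"
proof -
  have "openin (mtop M) {x \<in> topspace (mtop M). f x \<in> fst d}"
    using f openin_chart[OF N assms(5)] openin_continuous_map_preimage unfolding holomorphic_map_def by blast
  from open_chart_image[OF M assms(4) this]
  moreover have "fst c \<inter> {x \<in> topspace (mtop M). f x \<in> fst d} = fst c \<inter> f -` fst d"
    using openin_subset[OF openin_chart[OF M assms(4)]] by auto
  ultimately show ?thesis by simp
qed

lemma map_derivative:
  assumes f: "holomorphic_map M N f"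
    and c: "c \<in> charts_at M p" and d: "d \<in> charts_at N (f p)"
  shows "(snd d \<circ> f \<circ> chart_inv c has_derivative (\<lambda>v. map_jacobian f c d p *v v)) (at (snd c p))"
proof (rule hol_on_has_jacobian)
  show "hol_on (snd c ` (fst c \<inter> f -` fst d)) (snd d \<circ> f \<circ> chart_inv c)"
    using f c d unfolding holomorphic_map_def charts_at_def by blast
qed (use c d in \<open>auto simp: charts_at_def\<close>)

text \<open>Both sides are the Jacobian of \<open>f\<close> read from the chart \<open>c\<close> to the chart \<open>d'\<close>, computed once through
\<open>c'\<close> and once through \<open>d\<close>.\<close>

lemma map_jacobian_change:
  assumes M: "complex_manifold M" and N: "complex_manifold N" and f: "holomorphic_map M N f"
    and c: "c \<in> charts_at M p" "c' \<in> charts_at M p"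
    and d: "d \<in> charts_at N (f p)" "d' \<in> charts_at N (f p)"
  shows "map_jacobian f c' d' p ** chart_change c c' p = chart_change d d' (f p) ** map_jacobian f c d p"
proof -
  have cs: "c \<in> charts M" "c' \<in> charts M" "p \<in> fst c" "p \<in> fst c'"
    "d \<in> charts N" "d' \<in> charts N" "f p \<in> fst d" "f p \<in> fst d'"
    using c d by (auto simp: charts_at_charts)
  note inv = chart_inv_chart[OF M cs(1)] chart_inv_chart[OF M cs(2)] chart_inv_chart[OF N cs(5)]
  have 1: "(snd d' \<circ> f \<circ> chart_inv c' has_derivative (\<lambda>v. map_jacobian f c' d' p *v v)) (at ((snd c' \<circ> chart_inv c) (snd c p)))"
    using map_derivative[OF f c(2) d(2)] inv cs by simp
  have 2: "(snd d' \<circ> chart_inv d has_derivative (\<lambda>v. chart_change d d' (f p) *v v)) (at ((snd d \<circ> f \<circ> chart_inv c) (snd c p)))"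
    using chart_change_derivative[OF N d] inv cs by simp
  have "map_jacobian f c d' p = map_jacobian f c' d' p ** chart_change c c' p"
    by (rule complex_jacobian_chain[OF chart_change_derivative[OF M c] 1 open_chart_image[OF M cs(1) openin_chart[OF M cs(2)]]])
       (use cs inv in auto)
  moreover have "map_jacobian f c d' p = chart_change d d' (f p) ** map_jacobian f c d p"
    by (rule complex_jacobian_chain[OF map_derivative[OF f c(1) d(1)] 2 openin_preimage_chart[OF M N f cs(1,5)]])
       (use cs inv in auto)
  ultimately show ?thesis by simp
qed

section \<open>Lines in tangent and cotangent spaces\<close>

definition line_through :: "('a, 'k::finite) tvec \<Rightarrow> ('a, 'k) tvec set" where
  "line_through v = {(\<lambda>c. t *s v c) | t. True}"

text \<open>The map \<open>e\<close> sends components in the chart \<open>c\<close> to the (co)vector that has them. This is all that is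
used of a fibre below, so that lines of tangent vectors and of covectors can be treated together.\<close>

definition fibre_frame ::
  "('a, 'k::finite) tvec set \<Rightarrow> ('a, 'k) chart \<Rightarrow> (complex^'k \<Rightarrow> ('a, 'k) tvec) \<Rightarrow> bool" where
  "fibre_frame V c e \<longleftrightarrow> (\<forall>w. e w \<in> V \<and> e w c = w) \<and> (\<forall>v\<in>V. e (v c) = v) \<and>
     (\<forall>t w. e (t *s w) = (\<lambda>c'. t *s e w c'))"

definition tangent_frame :: "('a, 'k::finite) cmanifold \<Rightarrow> 'a \<Rightarrow> ('a, 'k) chart \<Rightarrow> complex^'k \<Rightarrow> ('a, 'k) tvec" where
  "tangent_frame M p c w = (\<lambda>c'. if c' \<in> charts_at M p then chart_change c c' p *v w else 0)"

definition cotangent_frame :: "('a, 'k::finite) cmanifold \<Rightarrow> 'a \<Rightarrow> ('a, 'k) chart \<Rightarrow> complex^'k \<Rightarrow> ('a, 'k) tvec" where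
  "cotangent_frame M p c w = (\<lambda>c'. if c' \<in> charts_at M p then transpose (chart_change c' c p) *v w else 0)"

lemma tangent_spaceD:
  assumes "v \<in> tangent_space M p"
  shows "c \<in> charts_at M p \<Longrightarrow> c' \<in> charts_at M p \<Longrightarrow> v c' = chart_change c c' p *v v c"
    and "c \<notin> charts_at M p \<Longrightarrow> v c = 0"
  using assms unfolding tangent_space_def by blast+

lemma cotangent_spaceD:
  assumes "\<theta> \<in> cotangent_space M p"
  shows "c \<in> charts_at M p \<Longrightarrow> c' \<in> charts_at M p \<Longrightarrow> \<theta> c = transpose (chart_change c c' p) *v \<theta> c'"
    and "c \<notin> charts_at M p \<Longrightarrow> \<theta> c = 0"
  using assms unfolding cotangent_space_def by blast+

lemma fibre_frame_tangent:
  assumes M: "complex_manifold M" and c: "c \<in> charts_at M p"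
  shows "fibre_frame (tangent_space M p) c (tangent_frame M p c)"
  unfolding fibre_frame_def
proof (intro conjI allI ballI)
  fix w and t :: complex
  show "tangent_frame M p c w \<in> tangent_space M p"
    unfolding tangent_space_def
  proof (intro CollectI conjI ballI allI impI)
    fix c' c'' assume "c' \<in> charts_at M p" "c'' \<in> charts_at M p"
    then show "tangent_frame M p c w c'' = chart_change c' c'' p *v tangent_frame M p c w c'"
      by (simp add: tangent_frame_def matrix_vector_mul_assoc chart_change_chain[OF M c])
  qed (simp add: tangent_frame_def)
  show "tangent_frame M p c w c = w"
    by (simp add: tangent_frame_def c chart_change_self[OF M c])
  show "tangent_frame M p c (t *s w) = (\<lambda>c'. t *s tangent_frame M p c w c')"
    by (rule ext) (simp add: tangent_frame_def vector_scalar_commute)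
next
  fix v assume v: "v \<in> tangent_space M p"
  show "tangent_frame M p c (v c) = v"
  proof
    fix c' show "tangent_frame M p c (v c) c' = v c'"
      using tangent_spaceD(1)[OF v c, of c'] tangent_spaceD(2)[OF v, of c'] by (simp add: tangent_frame_def)
  qed
qed

lemma fibre_frame_cotangent:
  assumes M: "complex_manifold M" and c: "c \<in> charts_at M p"
  shows "fibre_frame (cotangent_space M p) c (cotangent_frame M p c)"
  unfolding fibre_frame_def
proof (intro conjI allI ballI)
  fix w and t :: complex
  show "cotangent_frame M p c w \<in> cotangent_space M p"
    unfolding cotangent_space_def
  proof (intro CollectI conjI ballI allI impI)
    fix c' c'' assume "c' \<in> charts_at M p" "c'' \<in> charts_at M p"
    then show "cotangent_frame M p c w c' = transpose (chart_change c' c'' p) *v cotangent_frame M p c w c''"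
      by (simp add: cotangent_frame_def matrix_vector_mul_assoc matrix_transpose_mul[symmetric]
          chart_change_chain[OF M _ _ c] del: transpose_matrix_vector)
  qed (simp add: cotangent_frame_def)
  show "cotangent_frame M p c w c = w"
    by (simp add: cotangent_frame_def c chart_change_self[OF M c] transpose_mat del: transpose_matrix_vector)
  show "cotangent_frame M p c (t *s w) = (\<lambda>c'. t *s cotangent_frame M p c w c')"
    by (rule ext) (simp add: cotangent_frame_def vector_scalar_commute del: transpose_matrix_vector)
next
  fix v assume v: "v \<in> cotangent_space M p"
  show "cotangent_frame M p c (v c) = v"
  proof
    fix c' show "cotangent_frame M p c (v c) c' = v c'"
      using cotangent_spaceD(1)[OF v _ c, of c'] cotangent_spaceD(2)[OF v, of c']
      by (simp add: cotangent_frame_def del: transpose_matrix_vector)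
  qed
qed

lemma complex_lines_memD:
  assumes "fibre_frame V c e" "L \<in> complex_lines V" "v \<in> L" "v \<noteq> (\<lambda>_. 0)"
  shows "v \<in> V" "v c \<noteq> 0" "L = line_through v"
proof -
  obtain u where u: "u \<in> V" "L = line_through u"
    using assms(2) unfolding complex_lines_def line_through_def by blast
  obtain t where t: "v = (\<lambda>c. t *s u c)" using assms(3) u(2) unfolding line_through_def by blast
  have "v = e (t *s u c)" using assms(1) u(1) t unfolding fibre_frame_def by metis
  then show V: "v \<in> V" using assms(1) unfolding fibre_frame_def by metis
  have e: "e (v c) = v" and z: "e (0 *s v c) = (\<lambda>c'. 0 *s e (v c) c')"
    using assms(1) V unfolding fibre_frame_def by blast+
  show "v c \<noteq> 0"
  proof
    assume "v c = 0"
    \<comment> \<open>A (co)vector is determined by its components in \<open>c\<close>, so vanishing in \<open>c\<close> forces vanishing in all charts.\<close>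
    then have "v = (\<lambda>c'. 0 *s e (v c) c')" using e z by simp
    then show False using assms(4) by simp
  qed
  have "t \<noteq> 0" using t assms(4) by auto
  then have "(\<lambda>c. r *s u c) = (\<lambda>c. (r / t) *s v c)" for r by (simp add: t)
  moreover have "(\<lambda>c. r *s v c) = (\<lambda>c. (r * t) *s u c)" for r by (simp add: t)
  ultimately show "L = line_through v" unfolding u(2) line_through_def by blast
qed

lemma line_ratio_eq:
  assumes "fibre_frame V c e" "L \<in> complex_lines V" "v \<in> L" "v c $ \<alpha> \<noteq> 0"
  shows "line_ratio L c \<alpha> \<beta> = v c $ \<beta> / v c $ \<alpha>"
proof -
  have "v \<noteq> (\<lambda>_. 0)" using assms(4) by auto
  from complex_lines_memD(3)[OF assms(1-3) this] have L: "L = line_through v" .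
  show ?thesis
    unfolding line_ratio_def
  proof (rule the_equality)
    show "\<forall>u\<in>L. u c $ \<beta> = v c $ \<beta> / v c $ \<alpha> * u c $ \<alpha>"
      using assms(4) by (auto simp: L line_through_def)
    show "r = v c $ \<beta> / v c $ \<alpha>" if "\<forall>u\<in>L. u c $ \<beta> = r * u c $ \<alpha>" for r
      using that assms(3,4) by (simp add: field_simps)
  qed
qed

text \<open>The ratios \<open>W\<^sup>\<beta>/W\<^sup>\<alpha>\<close> are the components of the one vector on the line that is normalised by \<open>W\<^sup>\<alpha> = 1\<close>;
hence they determine the line.\<close>

lemma line_eq_frame:
  assumes fr: "fibre_frame V c e" and L: "L \<in> complex_lines V" and v: "v \<in> L" "v c $ \<alpha> \<noteq> 0"
  shows "L = line_through (e (\<chi> \<beta>. line_ratio L c \<alpha> \<beta>))"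
    and "e (\<chi> \<beta>. line_ratio L c \<alpha> \<beta>) \<in> L"
proof -
  have v0: "v \<noteq> (\<lambda>_. 0)" using v(2) by auto
  note D = complex_lines_memD[OF fr L v(1) v0]
  let ?u = "e (\<chi> \<beta>. line_ratio L c \<alpha> \<beta>)"
  have "(\<chi> \<beta>. line_ratio L c \<alpha> \<beta>) = inverse (v c $ \<alpha>) *s v c"
    by (simp add: vec_eq_iff line_ratio_eq[OF fr L v] divide_inverse mult.commute)
  then have u: "?u = (\<lambda>c'. inverse (v c $ \<alpha>) *s v c')"
    using fr D(1) unfolding fibre_frame_def by metis
  then show uL: "?u \<in> L" unfolding D(3) line_through_def by blast
  have "?u c $ \<alpha> \<noteq> 0" using v(2) by (simp add: u)
  then have "?u \<noteq> (\<lambda>_. 0)" by auto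
  then show "L = line_through ?u" using complex_lines_memD(3)[OF fr L uL] by blast
qed

lemma line_through_frame:
  assumes fr: "fibre_frame V c e" and w: "w $ \<alpha> = 1"
  shows "line_through (e w) \<in> complex_lines V" "e w \<in> line_through (e w)"
    "e w c $ \<alpha> \<noteq> 0" "line_ratio (line_through (e w)) c \<alpha> \<beta> = w $ \<beta>"
proof -
  have e: "e w \<in> V" "e w c = w" using fr unfolding fibre_frame_def by auto
  show n: "e w c $ \<alpha> \<noteq> 0" using e w by simp
  then have "e w \<noteq> (\<lambda>_. 0)" by auto
  then show L: "line_through (e w) \<in> complex_lines V"
    using e unfolding complex_lines_def line_through_def by blast
  show i: "e w \<in> line_through (e w)"
    unfolding line_through_def by (rule CollectI, rule exI[of _ 1]) simp
  show "line_ratio (line_through (e w)) c \<alpha> \<beta> = w $ \<beta>"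
    using line_ratio_eq[OF fr L i n] e w by simp
qed

section \<open>The coordinate expression of \<open>Y\<^sub>2\<close>\<close>

lemma metric_change:
  assumes h: "hermitian_metric M h" and c: "c \<in> charts_at M p" "c' \<in> charts_at M p"
  shows "h c p = transpose (chart_change c c' p) ** h c' p ** cnj_mat (chart_change c c' p)"
proof -
  let ?J = "chart_change c c' p"
  have "h c p $ \<alpha> $ \<beta> = (transpose ?J ** h c' p ** cnj_mat ?J) $ \<alpha> $ \<beta>" for \<alpha> \<beta>
  proof -
    have "h c p $ \<alpha> $ \<beta> = (\<Sum>\<gamma>\<in>UNIV. \<Sum>\<delta>\<in>UNIV. h c' p $ \<gamma> $ \<delta> * ?J $ \<gamma> $ \<alpha> * cnj (?J $ \<delta> $ \<beta>))"
      using h c unfolding hermitian_metric_def charts_at_def by blast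
    also have "\<dots> = (\<Sum>\<delta>\<in>UNIV. \<Sum>\<gamma>\<in>UNIV. h c' p $ \<gamma> $ \<delta> * ?J $ \<gamma> $ \<alpha> * cnj (?J $ \<delta> $ \<beta>))"
      by (rule sum.swap)
    finally show ?thesis
      unfolding matrix_matrix_mult_def transpose_def cnj_mat_def by (simp add: sum_distrib_left sum_distrib_right mult_ac)
  qed
  then show ?thesis by (simp add: vec_eq_iff)
qed

lemma metric_pos:
  assumes "hermitian_metric M h" "c \<in> charts_at M p" "v \<noteq> 0"
  shows "herm (h c p) v > 0"
  using assms unfolding hermitian_metric_def charts_at_def by blast

lemma dual_metric_pos:
  assumes "hermitian_metric M h" "c \<in> charts_at M p" "v \<noteq> 0"
  shows "herm (dual_metric h c p) v > 0"
  unfolding dual_metric_def by (rule herm_dual_pos[OF metric_pos[OF assms(1,2)] assms(3)])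

lemma herm_tangent_change:
  assumes "hermitian_metric M h" "c \<in> charts_at M p" "c' \<in> charts_at M p" "v \<in> tangent_space M p"
  shows "herm (h c p) (v c) = herm (h c' p) (v c')"
proof -
  have "v c' = chart_change c c' p *v v c" using assms(2-4) unfolding tangent_space_def by blast
  then show ?thesis using herm_change_basis[OF metric_change[OF assms(1-3)]] by simp
qed

lemma herm_cotangent_change:
  assumes M: "complex_manifold M" and h: "hermitian_metric M h"
    and c: "c \<in> charts_at M p" "c' \<in> charts_at M p" and \<theta>: "\<theta> \<in> cotangent_space M p"
  shows "herm (dual_metric h c p) (\<theta> c) = herm (dual_metric h c' p) (\<theta> c')"
  unfolding dual_metric_def
proof (rule herm_dual_change_basis[OF metric_change[OF h c]])
  show "invertible (h c p)" "invertible (h c' p)"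
    by (rule pos_def_invertible[OF metric_pos[OF h c(1)]], assumption)
      (rule pos_def_invertible[OF metric_pos[OF h c(2)]], assumption)
  show "invertible (chart_change c c' p)" by (rule chart_change_invertible[OF M c])
  show "\<theta> c = transpose (chart_change c c' p) *v \<theta> c'"
    using \<theta> c unfolding cotangent_space_def by blast
qed

text \<open>The numerator is the squared modulus of one complex number, the value of the covector \<open>X\<close> on the image
of \<open>W\<close> under the differential of \<open>f\<close>.\<close>

lemma Y2_coord_eq:
  "Y2_coord h g f c d p W X =
     (cmod (pairing X (map_jacobian f c d p *v W)))\<^sup>2 / (herm (dual_metric g d (f p)) X * herm (h c p) W)"
proof -
  let ?F = "map_jacobian f c d p"
  let ?s = "pairing X (?F *v W)"
  have s: "?s = (\<Sum>i\<in>UNIV. \<Sum>\<alpha>\<in>UNIV. X $ i * ?F $ i $ \<alpha> * W $ \<alpha>)"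
    by (simp add: pairing_def matrix_vector_mult_def sum_distrib_left mult.assoc)
  have "(\<Sum>i\<in>UNIV. \<Sum>j\<in>UNIV. \<Sum>\<alpha>\<in>UNIV. \<Sum>\<beta>\<in>UNIV.
            ?F $ i $ \<alpha> * cnj (?F $ j $ \<beta>) * X $ i * cnj (X $ j) * W $ \<alpha> * cnj (W $ \<beta>)) = ?s * cnj ?s"
    unfolding s cnj_sum sum_product by (simp add: mult_ac)
  also have "\<dots> = of_real ((cmod ?s)\<^sup>2)" by (rule complex_norm_square[symmetric])
  finally show ?thesis unfolding Y2_coord_def Let_def by (simp only: Re_complex_of_real)
qed

lemma Y2_coord_invariant:
  assumes M: "complex_manifold M" "hermitian_metric M h" and N: "complex_manifold N" "hermitian_metric N g"
    and f: "holomorphic_map M N f"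
    and c: "c \<in> charts_at M p" "c' \<in> charts_at M p"
    and d: "d \<in> charts_at N (f p)" "d' \<in> charts_at N (f p)"
    and v: "v \<in> tangent_space M p" and \<theta>: "\<theta> \<in> cotangent_space N (f p)"
  shows "Y2_coord h g f c d p (v c) (\<theta> d) = Y2_coord h g f c' d' p (v c') (\<theta> d')"
proof -
  have "v c' = chart_change c c' p *v v c" using v c unfolding tangent_space_def by blast
  then have "map_jacobian f c' d' p *v v c' = chart_change d d' (f p) *v (map_jacobian f c d p *v v c)"
    by (simp add: matrix_vector_mul_assoc map_jacobian_change[OF M(1) N(1) f c d])
  moreover have "\<theta> d = transpose (chart_change d d' (f p)) *v \<theta> d'"
    using \<theta> d unfolding cotangent_space_def by blast
  ultimately have "pairing (\<theta> d') (map_jacobian f c' d' p *v v c') = pairing (\<theta> d) (map_jacobian f c d p *v v c)"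
    by (simp only: pairing_transpose)
  then show ?thesis
    unfolding Y2_coord_eq
    using herm_tangent_change[OF M(2) c v] herm_cotangent_change[OF N d \<theta>] by simp
qed

lemma Y2_coord_scale:
  assumes "s \<noteq> 0" "t \<noteq> 0"
  shows "Y2_coord h g f c d p (s *s W) (t *s X) = Y2_coord h g f c d p W X"
  using assms
  by (simp add: Y2_coord_eq herm_scale pairing_scale vector_scalar_commute norm_mult power_mult_distrib)

lemma PfT_memD:
  assumes "q \<in> PfT M N f"
  shows "base_pt q \<in> topspace (mtop M)" "t_line q \<in> complex_lines (tangent_space M (base_pt q))"
    "ct_line q \<in> complex_lines (cotangent_space N (f (base_pt q)))"
  using assms unfolding PfT_def PT_def base_pt_def t_line_def ct_line_def by auto

text \<open>The definite description in \<open>Y2\<close> asks for a value common to all charts and all vectors on the two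
lines. Two nonzero vectors on a line differ by a nonzero scalar, so invariance under scaling and under
changes of charts gives such a value, and any single choice computes it.\<close>

lemma Y2_eq:
  assumes M: "complex_manifold M" "hermitian_metric M h" and N: "complex_manifold N" "hermitian_metric N g"
    and f: "holomorphic_map M N f" and q: "q \<in> PfT M N f"
    and c: "c \<in> charts_at M (base_pt q)" and d: "d \<in> charts_at N (f (base_pt q))"
    and v: "v \<in> t_line q" "v \<noteq> (\<lambda>_. 0)" and \<theta>: "\<theta> \<in> ct_line q" "\<theta> \<noteq> (\<lambda>_. 0)"
  shows "Y2 M h N g f q = Y2_coord h g f c d (base_pt q) (v c) (\<theta> d)"
  unfolding Y2_def
proof (rule the_equality)
  let ?p = "base_pt q"
  note t = complex_lines_memD[OF fibre_frame_tangent[OF M(1) c] PfT_memD(2)[OF q]]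
  note ct = complex_lines_memD[OF fibre_frame_cotangent[OF N(1) d] PfT_memD(3)[OF q]]
  show "\<forall>c'\<in>charts_at M ?p. \<forall>d'\<in>charts_at N (f ?p). \<forall>v'\<in>t_line q - {\<lambda>_. 0}. \<forall>\<theta>'\<in>ct_line q - {\<lambda>_. 0}.
      Y2_coord h g f c d ?p (v c) (\<theta> d) = Y2_coord h g f c' d' ?p (v' c') (\<theta>' d')"
  proof (intro ballI)
    fix c' d' v' \<theta>'
    assume c': "c' \<in> charts_at M ?p" and d': "d' \<in> charts_at N (f ?p)"
      and v': "v' \<in> t_line q - {\<lambda>_. 0}" and \<theta>': "\<theta>' \<in> ct_line q - {\<lambda>_. 0}"
    obtain s where s: "v' = (\<lambda>c. s *s v c)" using v' t(3)[OF v] unfolding line_through_def by blast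
    obtain r where r: "\<theta>' = (\<lambda>c. r *s \<theta> c)" using \<theta>' ct(3)[OF \<theta>] unfolding line_through_def by blast
    have "s \<noteq> 0" "r \<noteq> 0" using v' \<theta>' s r by auto
    then have "Y2_coord h g f c' d' ?p (v' c') (\<theta>' d') = Y2_coord h g f c' d' ?p (v c') (\<theta> d')"
      by (simp add: s r Y2_coord_scale)
    then show "Y2_coord h g f c d ?p (v c) (\<theta> d) = Y2_coord h g f c' d' ?p (v' c') (\<theta>' d')"
      using Y2_coord_invariant[OF M N f c c' d d' t(1)[OF v] ct(1)[OF \<theta>]] by simp
  qed
qed (use c d v \<theta> in blast)

section \<open>Metrics along holomorphic families of points\<close>

lemma twice_differentiable_on_vec:
  fixes F :: "'e::real_normed_vector \<Rightarrow> complex^'k::finite"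
  assumes S: "open S" and F: "\<And>i. twice_differentiable_on S (\<lambda>x. F x $ i)"
  shows "twice_differentiable_on S F"
proof (rule twice_differentiable_on_cong[OF S])
  have "bounded_linear (axis i :: complex \<Rightarrow> complex^'k)" for i
    by (intro linear_conv_bounded_linear[THEN iffD1] linearI) (auto simp: axis_def vec_eq_iff)
  then show "twice_differentiable_on S (\<lambda>x. \<Sum>i\<in>UNIV. axis i (F x $ i) :: complex^'k)"
    by (intro twice_differentiable_on_sum[OF S] twice_differentiable_on_linear[OF S _ F])
  show "(\<Sum>i\<in>UNIV. axis i (F x $ i)) = F x" for x
    by (simp add: vec_eq_iff axis_def if_distrib cong: if_cong)
qed

text \<open>The map \<open>pt\<close> takes values in the manifold, hence regularity is a property of its coordinates, and the
metric is composed with it through the chart \<open>c\<close>.\<close>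

lemma twice_differentiable_on_metric_along:
  fixes V :: "(complex^'d::finite) set"
  assumes Z: "complex_manifold Z" and A: "hermitian_metric Z A" and c: "c \<in> charts Z"
    and V: "open V" and pt: "\<And>\<zeta>. \<zeta> \<in> V \<Longrightarrow> pt \<zeta> \<in> fst c"
    and hol: "\<And>\<zeta> i. \<zeta> \<in> V \<Longrightarrow> cdifferentiable (\<lambda>\<zeta>. snd c (pt \<zeta>) $ i) \<zeta>"
  shows "twice_differentiable_on V (\<lambda>\<zeta>. A c (pt \<zeta>) $ a $ b)"
proof -
  have "smooth_on (snd c ` fst c) (\<lambda>z. A c (chart_inv c z))"
    using A c unfolding hermitian_metric_def by blast
  then have G: "twice_differentiable_on (snd c ` fst c) (\<lambda>z. A c (chart_inv c z))"
    by (rule smooth_imp_twice_differentiable)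
  have F: "twice_differentiable_on V (\<lambda>\<zeta>. snd c (pt \<zeta>))"
    by (intro twice_differentiable_on_vec cdifferentiable_imp_twice_differentiable V hol)
  have "twice_differentiable_on V (\<lambda>\<zeta>. A c (chart_inv c (snd c (pt \<zeta>))))"
    by (rule twice_differentiable_on_compose[OF V F G]) (use pt in auto)
  then have "twice_differentiable_on V (\<lambda>\<zeta>. A c (pt \<zeta>))"
    by (rule twice_differentiable_on_cong[OF V]) (simp add: chart_inv_chart[OF Z c pt])
  from twice_differentiable_on_linear[OF V bounded_linear_compose[OF bounded_linear_vec_nth bounded_linear_vec_nth] this]
  show ?thesis by simp
qed

lemma twice_differentiable_on_dual_metric_along:
  fixes V :: "(complex^'d::finite) set"
  assumes Z: "complex_manifold Z" and A: "hermitian_metric Z A" and c: "c \<in> charts Z"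
    and V: "open V" and pt: "\<And>\<zeta>. \<zeta> \<in> V \<Longrightarrow> pt \<zeta> \<in> fst c"
    and hol: "\<And>\<zeta> i. \<zeta> \<in> V \<Longrightarrow> cdifferentiable (\<lambda>\<zeta>. snd c (pt \<zeta>) $ i) \<zeta>"
  shows "twice_differentiable_on V (\<lambda>\<zeta>. dual_metric A c (pt \<zeta>) $ a $ b)"
proof -
  have "invertible (A c (pt \<zeta>))" if "\<zeta> \<in> V" for \<zeta>
    by (rule pos_def_invertible[OF metric_pos[OF A]]) (use c pt[OF that] in \<open>auto simp: charts_at_charts\<close>)
  from twice_differentiable_on_matrix_inv[OF V twice_differentiable_on_metric_along[OF assms] this]
  show ?thesis by (simp add: dual_metric_def transpose_def)
qed

lemma cdifferentiable_complex_jacobian: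
  assumes S: "open S" and F: "hol_on S F" and z: "z \<in> S"
  shows "cdifferentiable (\<lambda>z. complex_jacobian F z $ i $ a) z"
proof -
  have c: "cdifferentiable (\<lambda>z. F z $ i) x" if "x \<in> S" for x
    using F that unfolding hol_on_components by blast
  show ?thesis
    by (rule cdifferentiable_transform[OF cdifferentiable_frechet_derivative[OF S c z, where v = "axis a 1"] S z])
       (simp_all add: complex_jacobian_component[OF c])
qed

section \<open>Coordinates on the projectivised bundle\<close>

context
  fixes M :: "('a, 'm::finite) cmanifold" and N :: "('b, 'n::finite) cmanifold"
    and f :: "'a \<Rightarrow> 'b" and c :: "('a, 'm) chart" and d :: "('b, 'n) chart"
    and \<alpha> :: 'm and i :: 'n and e :: "'d::finite \<Rightarrow> 'm + 'm + 'n"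
  assumes M: "complex_manifold M" and N: "complex_manifold N" and f: "holomorphic_map M N f"
    and c: "c \<in> charts M" and d: "d \<in> charts N" and e: "bij_betw e UNIV (coord_index \<alpha> i)"
begin

abbreviation (input) "patch \<equiv> PfT_chart M N f c d \<alpha> i e"

text \<open>The next three functions extract from the coordinates \<open>\<zeta>\<close> the point of \<open>M\<close> and the homogeneous
coordinates of the two lines, normalised to \<open>1\<close> at the positions \<open>\<alpha>\<close> and \<open>i\<close> that the chart leaves
out.\<close>

definition base_coord :: "complex^'d \<Rightarrow> complex^'m" where
  "base_coord \<zeta> = (\<chi> \<gamma>. \<zeta> $ inv e (Inl \<gamma>))"

definition tangent_coord :: "complex^'d \<Rightarrow> complex^'m" where
  "tangent_coord \<zeta> = (\<chi> \<beta>. if \<beta> = \<alpha> then 1 else \<zeta> $ inv e (Inr (Inl \<beta>)))"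

definition cotangent_coord :: "complex^'d \<Rightarrow> complex^'n" where
  "cotangent_coord \<zeta> = (\<chi> j. if j = i then 1 else \<zeta> $ inv e (Inr (Inr j)))"

text \<open>The inverse of the chart. It does not refer to the chart as a map on the total space, so that
injectivity and the image of the chart can be read off from it.\<close>

definition point_of :: "complex^'d \<Rightarrow> ('a, 'm, 'b, 'n) ppoint" where
  "point_of \<zeta> = (let p = chart_inv c (base_coord \<zeta>) in
     ((p, line_through (tangent_frame M p c (tangent_coord \<zeta>))),
      line_through (cotangent_frame N (f p) d (cotangent_coord \<zeta>))))"

lemma index_inv:
  "e (inv e (Inl \<gamma>)) = Inl \<gamma>"
  "\<beta> \<noteq> \<alpha> \<Longrightarrow> e (inv e (Inr (Inl \<beta>))) = Inr (Inl \<beta>)"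
  "j \<noteq> i \<Longrightarrow> e (inv e (Inr (Inr j))) = Inr (Inr j)"
  "inv e (e a) = a"
proof -
  have img: "e ` UNIV = coord_index \<alpha> i" and inj: "inj e" using e unfolding bij_betw_def by auto
  have *: "e (inv e x) = x" if "x \<in> coord_index \<alpha> i" for x
    using that img by (intro f_inv_into_f) blast
  show "e (inv e (Inl \<gamma>)) = Inl \<gamma>" by (rule *) (simp add: coord_index_def)
  show "\<beta> \<noteq> \<alpha> \<Longrightarrow> e (inv e (Inr (Inl \<beta>))) = Inr (Inl \<beta>)" by (rule *) (auto simp: coord_index_def)
  show "j \<noteq> i \<Longrightarrow> e (inv e (Inr (Inr j))) = Inr (Inr j)" by (rule *) (auto simp: coord_index_def)
  show "inv e (e a) = a" using inj by simp
qed

lemma index_cases: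
  obtains \<gamma> where "e a = Inl \<gamma>" | \<beta> where "e a = Inr (Inl \<beta>)" "\<beta> \<noteq> \<alpha>" | j where "e a = Inr (Inr j)" "j \<noteq> i"
proof -
  have "e a \<in> coord_index \<alpha> i" using e unfolding bij_betw_def by auto
  then show thesis using that unfolding coord_index_def by auto
qed

lemma patch_mem:
  "q \<in> fst patch \<longleftrightarrow> q \<in> PfT M N f \<and> base_pt q \<in> fst c \<and> f (base_pt q) \<in> fst d \<and>
     (\<exists>v\<in>t_line q. v c $ \<alpha> \<noteq> 0) \<and> (\<exists>\<theta>\<in>ct_line q. \<theta> d $ i \<noteq> 0)"
  by (simp add: PfT_chart_def)

lemma patch_coord:
  "snd patch q $ a = (case e a of
          Inl \<gamma> \<Rightarrow> snd c (base_pt q) $ \<gamma>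
        | Inr (Inl \<beta>) \<Rightarrow> line_ratio (t_line q) c \<alpha> \<beta>
        | Inr (Inr j) \<Rightarrow> line_ratio (ct_line q) d i j)"
  by (simp add: PfT_chart_def)

lemma patch_frames:
  assumes "q \<in> fst patch"
  shows "fibre_frame (tangent_space M (base_pt q)) c (tangent_frame M (base_pt q) c)"
    and "fibre_frame (cotangent_space N (f (base_pt q))) d (cotangent_frame N (f (base_pt q)) d)"
  using fibre_frame_tangent[OF M] fibre_frame_cotangent[OF N] assms c d
  by (auto simp: patch_mem charts_at_charts)

lemma patch_lines:
  assumes "q \<in> fst patch"
  shows "q \<in> PfT M N f" "t_line q \<in> complex_lines (tangent_space M (base_pt q))"
    "ct_line q \<in> complex_lines (cotangent_space N (f (base_pt q)))"
  using assms PfT_memD[of q M N f] by (simp_all only: patch_mem)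

lemma coords_of_point:
  assumes q: "q \<in> fst patch"
  shows "base_coord (snd patch q) = snd c (base_pt q)"
    and "tangent_coord (snd patch q) = (\<chi> \<beta>. line_ratio (t_line q) c \<alpha> \<beta>)"
    and "cotangent_coord (snd patch q) = (\<chi> j. line_ratio (ct_line q) d i j)"
proof -
  note P = q[unfolded patch_mem]
  obtain v \<theta> where v: "v \<in> t_line q" "v c $ \<alpha> \<noteq> 0" and \<theta>: "\<theta> \<in> ct_line q" "\<theta> d $ i \<noteq> 0"
    using P by blast
  show "base_coord (snd patch q) = snd c (base_pt q)"
    by (simp add: vec_eq_iff base_coord_def patch_coord index_inv)
  \<comment> \<open>This matches the value \<open>1\<close> that \<open>tangent_coord\<close> inserts at the position without a coordinate.\<close>
  have "line_ratio (t_line q) c \<alpha> \<alpha> = 1"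
    using line_ratio_eq[OF patch_frames(1)[OF q] patch_lines(2)[OF q] v] P v by simp
  then show "tangent_coord (snd patch q) = (\<chi> \<beta>. line_ratio (t_line q) c \<alpha> \<beta>)"
    by (auto simp: vec_eq_iff tangent_coord_def patch_coord index_inv)
  have "line_ratio (ct_line q) d i i = 1"
    using line_ratio_eq[OF patch_frames(2)[OF q] patch_lines(3)[OF q] \<theta>] P \<theta> by simp
  then show "cotangent_coord (snd patch q) = (\<chi> j. line_ratio (ct_line q) d i j)"
    by (auto simp: vec_eq_iff cotangent_coord_def patch_coord index_inv)
qed

lemma point_of_coords:
  assumes q: "q \<in> fst patch"
  shows "point_of (snd patch q) = q"
proof -
  note P = q[unfolded patch_mem]
  obtain v \<theta> where v: "v \<in> t_line q" "v c $ \<alpha> \<noteq> 0" and \<theta>: "\<theta> \<in> ct_line q" "\<theta> d $ i \<noteq> 0"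
    using P by blast
  have p: "chart_inv c (snd c (base_pt q)) = base_pt q" using chart_inv_chart[OF M c] P by blast
  have "point_of (snd patch q) = ((base_pt q, t_line q), ct_line q)"
    unfolding point_of_def coords_of_point[OF q] p Let_def
    using line_eq_frame(1)[OF patch_frames(1)[OF q] patch_lines(2)[OF q] v]
      line_eq_frame(1)[OF patch_frames(2)[OF q] patch_lines(3)[OF q] \<theta>] P by simp
  then show ?thesis by (simp add: base_pt_def t_line_def ct_line_def)
qed

lemma coords_of_point_of:
  assumes \<zeta>: "base_coord \<zeta> \<in> snd c ` (fst c \<inter> f -` fst d)"
  shows "point_of \<zeta> \<in> fst patch" "snd patch (point_of \<zeta>) = \<zeta>"
    "base_pt (point_of \<zeta>) = chart_inv c (base_coord \<zeta>)"
proof -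
  define p where "p = chart_inv c (base_coord \<zeta>)"
  obtain x where x: "x \<in> fst c" "f x \<in> fst d" "base_coord \<zeta> = snd c x" using \<zeta> by auto
  then have p: "p \<in> fst c" "f p \<in> fst d" "snd c p = base_coord \<zeta>"
    using chart_inv_chart[OF M c] by (auto simp: p_def)
  let ?q = "point_of \<zeta>"
  have q: "base_pt ?q = p" "t_line ?q = line_through (tangent_frame M p c (tangent_coord \<zeta>))"
    "ct_line ?q = line_through (cotangent_frame N (f p) d (cotangent_coord \<zeta>))"
    by (simp_all add: point_of_def Let_def p_def base_pt_def t_line_def ct_line_def)
  then show "base_pt ?q = chart_inv c (base_coord \<zeta>)" by (simp add: p_def)
  have fr: "fibre_frame (tangent_space M p) c (tangent_frame M p c)"
    "fibre_frame (cotangent_space N (f p)) d (cotangent_frame N (f p) d)"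
    using fibre_frame_tangent[OF M] fibre_frame_cotangent[OF N] p c d by (auto simp: charts_at_charts)
  note t = line_through_frame[OF fr(1), of "tangent_coord \<zeta>" \<alpha>]
  note ct = line_through_frame[OF fr(2), of "cotangent_coord \<zeta>" i]
  have one: "tangent_coord \<zeta> $ \<alpha> = 1" "cotangent_coord \<zeta> $ i = 1"
    by (simp_all add: tangent_coord_def cotangent_coord_def)
  have "p \<in> topspace (mtop M)" using p(1) openin_subset[OF openin_chart[OF M c]] by blast
  then have "?q \<in> PfT M N f"
    using t(1)[OF one(1)] ct(1)[OF one(2)] by (simp add: PfT_def PT_def point_of_def Let_def p_def)
  moreover have "\<exists>v\<in>t_line ?q. v c $ \<alpha> \<noteq> 0" "\<exists>\<theta>\<in>ct_line ?q. \<theta> d $ i \<noteq> 0"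
    unfolding q using t(2,3)[OF one(1)] ct(2,3)[OF one(2)] by blast+
  ultimately show "?q \<in> fst patch" unfolding patch_mem using p q by blast
  show "snd patch ?q = \<zeta>"
  proof (subst vec_eq_iff, rule allI)
    fix a show "snd patch ?q $ a = \<zeta> $ a"
    proof (cases rule: index_cases[of a])
      case (1 \<gamma>)
      then have "inv e (Inl \<gamma>) = a" using index_inv(4)[of a] by simp
      then show ?thesis by (simp add: patch_coord q 1 p(3) base_coord_def)
    next
      case (2 \<beta>)
      then have "inv e (Inr (Inl \<beta>)) = a" using index_inv(4)[of a] by simp
      moreover have "snd patch ?q $ a = tangent_coord \<zeta> $ \<beta>"
        by (simp add: patch_coord q 2 t(4)[OF one(1)])
      ultimately show ?thesis using 2 by (simp add: tangent_coord_def)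
    next
      case (3 j)
      then have "inv e (Inr (Inr j)) = a" using index_inv(4)[of a] by simp
      moreover have "snd patch ?q $ a = cotangent_coord \<zeta> $ j"
        by (simp add: patch_coord q 3 ct(4)[OF one(2)])
      ultimately show ?thesis using 3 by (simp add: cotangent_coord_def)
    qed
  qed
qed

lemma patch_chart_inv: "q \<in> fst patch \<Longrightarrow> chart_inv patch (snd patch q) = q"
  unfolding chart_inv_def by (intro inv_into_f_f inj_on_inverseI[where g = point_of] point_of_coords)

text \<open>The fibre coordinates are arbitrary; only the base point is constrained to lie in the chart of \<open>M\<close>
and to be mapped into the chart of \<open>N\<close>.\<close>

lemma patch_image: "snd patch ` fst patch = {\<zeta>. base_coord \<zeta> \<in> snd c ` (fst c \<inter> f -` fst d)}"
proof (intro equalityI subsetI)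
  fix \<zeta> assume "\<zeta> \<in> snd patch ` fst patch"
  then obtain q where "q \<in> fst patch" "\<zeta> = snd patch q" by blast
  then show "\<zeta> \<in> {\<zeta>. base_coord \<zeta> \<in> snd c ` (fst c \<inter> f -` fst d)}"
    using coords_of_point(1)[of q] by (auto simp: patch_mem)
next
  fix \<zeta> assume "\<zeta> \<in> {\<zeta>. base_coord \<zeta> \<in> snd c ` (fst c \<inter> f -` fst d)}"
  then show "\<zeta> \<in> snd patch ` fst patch"
    using coords_of_point_of[of \<zeta>] by (intro image_eqI[of _ _ "point_of \<zeta>"]) simp_all
qed

lemma cdifferentiable_coords:
  "cdifferentiable (\<lambda>\<zeta>. base_coord \<zeta> $ \<gamma>) z" "cdifferentiable (\<lambda>\<zeta>. tangent_coord \<zeta> $ \<gamma>) z" "cdifferentiable (\<lambda>\<zeta>. cotangent_coord \<zeta> $ j) z"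
proof -
  show "cdifferentiable (\<lambda>\<zeta>. base_coord \<zeta> $ \<gamma>) z" by (simp add: base_coord_def cdifferentiable_component)
  show "cdifferentiable (\<lambda>\<zeta>. tangent_coord \<zeta> $ \<gamma>) z"
    by (cases "\<gamma> = \<alpha>") (simp_all add: tangent_coord_def cdifferentiable_component cdifferentiable_const)
  show "cdifferentiable (\<lambda>\<zeta>. cotangent_coord \<zeta> $ j) z"
    by (cases "j = i") (simp_all add: cotangent_coord_def cdifferentiable_component cdifferentiable_const)
qed

lemma open_patch_image: "open (snd patch ` fst patch)"
proof -
  have "continuous_on UNIV base_coord"
    unfolding base_coord_def by (intro continuous_intros)
  then have "open (base_coord -` (snd c ` (fst c \<inter> f -` fst d)))"
    using openin_preimage_chart[OF M N f c d] open_vimage by blast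
  then show ?thesis by (simp add: patch_image vimage_def)
qed

lemma base_pt_patch_inv:
  assumes "\<zeta> \<in> snd patch ` fst patch"
  shows "base_pt (chart_inv patch \<zeta>) = chart_inv c (base_coord \<zeta>)"
    "base_coord \<zeta> \<in> snd c ` (fst c \<inter> f -` fst d)"
    "chart_inv patch \<zeta> = point_of \<zeta>" "chart_inv patch \<zeta> \<in> fst patch" "snd patch (chart_inv patch \<zeta>) = \<zeta>"
proof -
  show b: "base_coord \<zeta> \<in> snd c ` (fst c \<inter> f -` fst d)" using assms patch_image by blast
  show i: "chart_inv patch \<zeta> = point_of \<zeta>"
    using patch_chart_inv[OF coords_of_point_of(1)[OF b]] coords_of_point_of(2)[OF b] by simp
  show "base_pt (chart_inv patch \<zeta>) = chart_inv c (base_coord \<zeta>)"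
    "chart_inv patch \<zeta> \<in> fst patch" "snd patch (chart_inv patch \<zeta>) = \<zeta>"
    unfolding i using coords_of_point_of[OF b] by auto
qed

text \<open>The chart \<open>c'\<close> need not be the one from which the coordinates \<open>\<zeta>\<close> were made: the homogeneous
coordinates that define the two forms may be taken with respect to any chart. A change of
coordinates on \<open>M\<close> relates the two.\<close>

lemma cdifferentiable_base_coord:
  assumes V: "open V" "V \<subseteq> snd patch ` fst patch" "\<zeta> \<in> V"
    and c': "c' \<in> charts M" "\<And>\<zeta>. \<zeta> \<in> V \<Longrightarrow> base_pt (chart_inv patch \<zeta>) \<in> fst c'"
  shows "cdifferentiable (\<lambda>\<zeta>. snd c' (base_pt (chart_inv patch \<zeta>)) $ a) \<zeta>"
proof (rule cdifferentiable_transform[OF _ V(1,3)])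
  have h: "hol_on (snd c ` (fst c \<inter> fst c')) (snd c' \<circ> chart_inv c)"
    using M c c' unfolding complex_manifold_def by blast
  have eq: "base_pt (chart_inv patch x) = chart_inv c (base_coord x)" if "x \<in> V" for x
    using base_pt_patch_inv(1) V(2) that by blast
  have "base_coord \<zeta> \<in> snd c ` (fst c \<inter> fst c')"
    using base_pt_patch_inv(2)[OF subsetD[OF V(2,3)]] c'(2)[OF V(3)]
    by (auto simp: eq[OF V(3)] chart_inv_chart[OF M c])
  then have "cdifferentiable (\<lambda>z. (snd c' \<circ> chart_inv c) z $ a) (base_coord \<zeta>)"
    using h unfolding hol_on_components by blast
  from cdifferentiable_compose[OF this cdifferentiable_coords(1)]
  show "cdifferentiable (\<lambda>\<zeta>. (snd c' \<circ> chart_inv c) (base_coord \<zeta>) $ a) \<zeta>" .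
  show "(snd c' \<circ> chart_inv c) (base_coord x) $ a = snd c' (base_pt (chart_inv patch x)) $ a" if "x \<in> V" for x
    using eq[OF that] by simp
qed

lemma cdifferentiable_image_coord:
  assumes V: "open V" "V \<subseteq> snd patch ` fst patch" "\<zeta> \<in> V"
    and d': "d' \<in> charts N" "\<And>\<zeta>. \<zeta> \<in> V \<Longrightarrow> f (base_pt (chart_inv patch \<zeta>)) \<in> fst d'"
  shows "cdifferentiable (\<lambda>\<zeta>. snd d' (f (base_pt (chart_inv patch \<zeta>))) $ a) \<zeta>"
proof (rule cdifferentiable_transform[OF _ V(1,3)])
  have h: "hol_on (snd c ` (fst c \<inter> f -` fst d')) (snd d' \<circ> f \<circ> chart_inv c)"
    using f c d' unfolding holomorphic_map_def by blast
  have eq: "base_pt (chart_inv patch x) = chart_inv c (base_coord x)" if "x \<in> V" for x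
    using base_pt_patch_inv(1) V(2) that by blast
  have "base_coord \<zeta> \<in> snd c ` (fst c \<inter> f -` fst d')"
    using base_pt_patch_inv(2)[OF subsetD[OF V(2,3)]] d'(2)[OF V(3)]
    by (auto simp: eq[OF V(3)] chart_inv_chart[OF M c])
  then have "cdifferentiable (\<lambda>z. (snd d' \<circ> f \<circ> chart_inv c) z $ a) (base_coord \<zeta>)"
    using h unfolding hol_on_components by blast
  from cdifferentiable_compose[OF this cdifferentiable_coords(1)]
  show "cdifferentiable (\<lambda>\<zeta>. (snd d' \<circ> f \<circ> chart_inv c) (base_coord \<zeta>) $ a) \<zeta>" .
  show "(snd d' \<circ> f \<circ> chart_inv c) (base_coord x) $ a = snd d' (f (base_pt (chart_inv patch x))) $ a" if "x \<in> V" for x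
    using eq[OF that] by simp
qed

text \<open>The sections normalised by \<open>W\<^sup>\<alpha> = 1\<close> and \<open>X\<^sub>i = 1\<close> have constants and coordinate functions as components.
Their existence is what makes the choice in the definition of the two forms meaningful.\<close>

lemma hom_coords_exist:
  assumes q: "q \<in> fst patch"
  shows "hom_coords patch q base_pt t_line c (fst patch)
      (\<lambda>r. tangent_frame M (base_pt r) c (tangent_coord (snd patch r)))" (is "hom_coords _ _ _ _ _ _ ?\<sigma>")
    and "hom_coords patch q (f \<circ> base_pt) ct_line d (fst patch)
      (\<lambda>r. cotangent_frame N (f (base_pt r)) d (cotangent_coord (snd patch r)))" (is "hom_coords _ _ _ _ _ _ ?\<tau>")
proof -
  have nz: "tangent_coord \<zeta> \<noteq> 0" "cotangent_coord \<zeta> \<noteq> 0" for \<zeta>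
  proof -
    have "tangent_coord \<zeta> $ \<alpha> = 1" "cotangent_coord \<zeta> $ i = 1"
      by (simp_all add: tangent_coord_def cotangent_coord_def)
    then show "tangent_coord \<zeta> \<noteq> 0" "cotangent_coord \<zeta> \<noteq> 0" by auto
  qed
  have comp: "?\<sigma> r c = tangent_coord (snd patch r)" "?\<tau> r d = cotangent_coord (snd patch r)" if "r \<in> fst patch" for r
    using patch_frames[OF that] unfolding fibre_frame_def by blast+
  have comp': "tangent_coord \<zeta> = ?\<sigma> (chart_inv patch \<zeta>) c"
    "cotangent_coord \<zeta> = ?\<tau> (chart_inv patch \<zeta>) d" if "\<zeta> \<in> snd patch ` fst patch" for \<zeta>
    using comp[OF base_pt_patch_inv(4)[OF that]] base_pt_patch_inv(5)[OF that] by simp_all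
  have hol: "hol_on (snd patch ` fst patch) (\<lambda>\<zeta>. ?\<sigma> (chart_inv patch \<zeta>) c)"
    "hol_on (snd patch ` fst patch) (\<lambda>\<zeta>. ?\<tau> (chart_inv patch \<zeta>) d)"
    unfolding hol_on_components
  proof (intro ballI allI)
    fix \<zeta> a assume \<zeta>: "\<zeta> \<in> snd patch ` fst patch"
    show "cdifferentiable (\<lambda>\<zeta>. ?\<sigma> (chart_inv patch \<zeta>) c $ a) \<zeta>"
      by (rule cdifferentiable_transform[OF cdifferentiable_coords(2)[of a] open_patch_image \<zeta>]) (simp only: comp')
  next
    show "\<forall>\<zeta>\<in>snd patch ` fst patch. \<forall>a. cdifferentiable (\<lambda>\<zeta>. ?\<tau> (chart_inv patch \<zeta>) d $ a) \<zeta>"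
    proof (intro ballI allI)
      fix \<zeta> a assume \<zeta>: "\<zeta> \<in> snd patch ` fst patch"
      show "cdifferentiable (\<lambda>\<zeta>. ?\<tau> (chart_inv patch \<zeta>) d $ a) \<zeta>"
        by (rule cdifferentiable_transform[OF cdifferentiable_coords(3)[of a] open_patch_image \<zeta>]) (simp only: comp')
    qed
  qed
  have mem: "base_pt r \<in> fst c \<and> ?\<sigma> r \<in> t_line r \<and> ?\<sigma> r \<noteq> (\<lambda>_. 0)"
    "f (base_pt r) \<in> fst d \<and> ?\<tau> r \<in> ct_line r \<and> ?\<tau> r \<noteq> (\<lambda>_. 0)" if r: "r \<in> fst patch" for r
  proof -
    note P = r[unfolded patch_mem]
    obtain v \<theta> where v: "v \<in> t_line r" "v c $ \<alpha> \<noteq> 0" and \<theta>: "\<theta> \<in> ct_line r" "\<theta> d $ i \<noteq> 0"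
      using P by blast
    have "?\<sigma> r \<in> t_line r" "?\<tau> r \<in> ct_line r"
      unfolding coords_of_point[OF r]
      using line_eq_frame(2)[OF patch_frames(1)[OF r] patch_lines(2)[OF r] v]
        line_eq_frame(2)[OF patch_frames(2)[OF r] patch_lines(3)[OF r] \<theta>] P by auto
    moreover have "?\<sigma> r \<noteq> (\<lambda>_. 0)" using comp(1)[OF r] nz by metis
    moreover have "?\<tau> r \<noteq> (\<lambda>_. 0)" using comp(2)[OF r] nz by metis
    ultimately show "base_pt r \<in> fst c \<and> ?\<sigma> r \<in> t_line r \<and> ?\<sigma> r \<noteq> (\<lambda>_. 0)"
      "f (base_pt r) \<in> fst d \<and> ?\<tau> r \<in> ct_line r \<and> ?\<tau> r \<noteq> (\<lambda>_. 0)" using P by blast+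
  qed
  show "hom_coords patch q base_pt t_line c (fst patch) ?\<sigma>"
    unfolding hom_coords_def using q open_patch_image mem(1) hol(1) by blast
  show "hom_coords patch q (f \<circ> base_pt) ct_line d (fst patch) ?\<tau>"
    unfolding hom_coords_def o_apply using q open_patch_image mem(2) hol(2) by blast
qed

section \<open>The inequality for arbitrary homogeneous coordinates\<close>

text \<open>The two sections and their charts downstairs are arbitrary. In terms of them
\<open>Y\<^sub>2 = |s|\<^sup>2 / (H\<^sub>1 H)\<close> near \<open>q\<close>, with the very functions \<open>H\<close> and \<open>H\<^sub>1\<close> whose logarithms define the two
forms, and \<open>semi_positive_weighted_norm\<close> applies.\<close>

lemma hessian_inequality:
  fixes h :: "('a, 'm) metric" and g :: "('b, 'n) metric"
  assumes h: "hermitian_metric M h" and g: "hermitian_metric N g" and q: "q \<in> fst patch"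
    and c': "c' \<in> charts M" and \<sigma>: "hom_coords patch q base_pt t_line c' U \<sigma>"
    and d': "d' \<in> charts N" and \<tau>: "hom_coords patch q (f \<circ> base_pt) ct_line d' U' \<tau>"
  shows "semi_positive (i_ddbar (Y2 M h N g f) patch q - Y2 M h N g f q *\<^sub>R
     (i_ddbar (\<lambda>r. ln (inverse (herm (h c' (base_pt r)) (\<sigma> r c')))) patch q +
      i_ddbar (\<lambda>r. ln (inverse (herm (dual_metric g d' ((f \<circ> base_pt) r)) (\<tau> r d')))) patch q))"
proof -
  \<comment> \<open>The two sections live over different neighbourhoods; everything takes place over the common part.\<close>
  define V where "V = snd patch ` U \<inter> snd patch ` U'"
  define z where "z = snd patch q"
  define r where "r \<zeta> = chart_inv patch \<zeta>" for \<zeta>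
  have sub: "U \<subseteq> fst patch" "U' \<subseteq> fst patch" and op: "open V" and z: "z \<in> V"
    using \<sigma> \<tau> unfolding hom_coords_def V_def z_def by auto
  have VP: "V \<subseteq> snd patch ` fst patch" using sub unfolding V_def by blast
  have rU: "r \<zeta> \<in> U" "r \<zeta> \<in> U'" if "\<zeta> \<in> V" for \<zeta>
  proof -
    obtain u u' where "u \<in> U" "\<zeta> = snd patch u" "u' \<in> U'" "\<zeta> = snd patch u'"
      using \<open>\<zeta> \<in> V\<close> unfolding V_def by blast
    moreover from this have "r \<zeta> = u" "r \<zeta> = u'"
      using patch_chart_inv[OF subsetD[OF sub(1)], of u] patch_chart_inv[OF subsetD[OF sub(2)], of u']
      by (simp_all add: r_def)
    ultimately show "r \<zeta> \<in> U" "r \<zeta> \<in> U'" by simp_all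
  qed
  have rz: "r z = q" unfolding r_def z_def by (rule patch_chart_inv[OF q])
  have S: "base_pt (r \<zeta>) \<in> fst c'" "\<sigma> (r \<zeta>) \<in> t_line (r \<zeta>)" "\<sigma> (r \<zeta>) \<noteq> (\<lambda>_. 0)"
    and T: "f (base_pt (r \<zeta>)) \<in> fst d'" "\<tau> (r \<zeta>) \<in> ct_line (r \<zeta>)" "\<tau> (r \<zeta>) \<noteq> (\<lambda>_. 0)"
    if "\<zeta> \<in> V" for \<zeta>
    using rU[OF that] \<sigma> \<tau> unfolding hom_coords_def by auto
  have rP: "r \<zeta> \<in> PfT M N f" if "\<zeta> \<in> V" for \<zeta>
    by (rule patch_lines(1)[OF subsetD[OF sub(1) rU(1)[OF that]]])
  have at: "c' \<in> charts_at M (base_pt (r \<zeta>))" "d' \<in> charts_at N (f (base_pt (r \<zeta>)))" if "\<zeta> \<in> V" for \<zeta>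
    using S T c' d' that by (auto simp: charts_at_charts)
  define W where "W \<zeta> = \<sigma> (r \<zeta>) c'" for \<zeta>
  define X where "X \<zeta> = \<tau> (r \<zeta>) d'" for \<zeta>
  have W: "cdifferentiable (\<lambda>\<zeta>. W \<zeta> $ a) \<zeta>" "W \<zeta> \<noteq> 0" and X: "cdifferentiable (\<lambda>\<zeta>. X \<zeta> $ b) \<zeta>" "X \<zeta> \<noteq> 0" if "\<zeta> \<in> V" for \<zeta> a b
  proof -
    show "cdifferentiable (\<lambda>\<zeta>. W \<zeta> $ a) \<zeta>" "cdifferentiable (\<lambda>\<zeta>. X \<zeta> $ b) \<zeta>"
      using that \<sigma> \<tau> unfolding hom_coords_def hol_on_components W_def X_def V_def r_def by blast+
    show "W \<zeta> \<noteq> 0" unfolding W_def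
      by (rule complex_lines_memD(2)[OF fibre_frame_tangent[OF M at(1)[OF that]] PfT_memD(2)[OF rP[OF that]] S(2,3)[OF that]])
    show "X \<zeta> \<noteq> 0" unfolding X_def
      by (rule complex_lines_memD(2)[OF fibre_frame_cotangent[OF N at(2)[OF that]] PfT_memD(3)[OF rP[OF that]] T(2,3)[OF that]])
  qed
  have B: "cdifferentiable (\<lambda>\<zeta>. snd c' (base_pt (r \<zeta>)) $ a) \<zeta>" if "\<zeta> \<in> V" for \<zeta> a
    unfolding r_def by (rule cdifferentiable_base_coord[OF op VP that c']) (use S(1) r_def in auto)
  have I: "cdifferentiable (\<lambda>\<zeta>. snd d' (f (base_pt (r \<zeta>))) $ a) \<zeta>" if "\<zeta> \<in> V" for \<zeta> a
    unfolding r_def by (rule cdifferentiable_image_coord[OF op VP that d']) (use T(1) r_def in auto)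
  define H where "H \<zeta> = herm (h c' (base_pt (r \<zeta>))) (W \<zeta>)" for \<zeta>
  define H1 where "H1 \<zeta> = herm (dual_metric g d' (f (base_pt (r \<zeta>)))) (X \<zeta>)" for \<zeta>
  define s where "s \<zeta> = pairing (X \<zeta>) (map_jacobian f c' d' (base_pt (r \<zeta>)) *v W \<zeta>)" for \<zeta>
  have "cdifferentiable s \<zeta>" if \<zeta>: "\<zeta> \<in> V" for \<zeta>
  proof -
    have "cdifferentiable (\<lambda>z. complex_jacobian (snd d' \<circ> f \<circ> chart_inv c') z $ j $ a) (snd c' (base_pt (r \<zeta>)))" for j a
    proof (rule cdifferentiable_complex_jacobian[OF openin_preimage_chart[OF M N f c' d']])
      show "hol_on (snd c' ` (fst c' \<inter> f -` fst d')) (snd d' \<circ> f \<circ> chart_inv c')"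
        using f c' d' unfolding holomorphic_map_def by blast
      show "snd c' (base_pt (r \<zeta>)) \<in> snd c' ` (fst c' \<inter> f -` fst d')"
        using S(1) T(1) \<zeta> by auto
    qed
    from cdifferentiable_compose[OF this B[OF \<zeta>]]
    have "cdifferentiable (\<lambda>\<zeta>. map_jacobian f c' d' (base_pt (r \<zeta>)) $ j $ a) \<zeta>" for j a .
    then show ?thesis
      unfolding s_def pairing_def matrix_vector_mult_def
      by (simp add: cdifferentiable_sum cdifferentiable_mult W(1)[OF \<zeta>] X(1)[OF \<zeta>])
  qed
  moreover have "twice_differentiable_on V H"
    unfolding H_def
    by (intro twice_differentiable_on_herm twice_differentiable_on_metric_along[OF M h c']
          cdifferentiable_imp_twice_differentiable op B W S)
  moreover have "twice_differentiable_on V H1"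
    unfolding H1_def
    by (intro twice_differentiable_on_herm twice_differentiable_on_dual_metric_along[OF N g d']
          cdifferentiable_imp_twice_differentiable op I X T)
  moreover have "H \<zeta> > 0" "H1 \<zeta> > 0" if "\<zeta> \<in> V" for \<zeta>
    unfolding H_def H1_def
    using metric_pos[OF h at(1) W(2)] dual_metric_pos[OF g at(2) X(2)] that by auto
  moreover have "Y2 M h N g f (r \<zeta>) = (cmod (s \<zeta>))\<^sup>2 / (H1 \<zeta> * H \<zeta>)" if \<zeta>: "\<zeta> \<in> V" for \<zeta>
    unfolding Y2_eq[OF M h N g f rP[OF \<zeta>] at[OF \<zeta>] S(2,3)[OF \<zeta>] T(2,3)[OF \<zeta>]] Y2_coord_eq
    by (simp add: s_def H_def H1_def W_def X_def)
  ultimately have "semi_positive (complex_hessian (\<lambda>\<zeta>. complex_of_real (Y2 M h N g f (r \<zeta>))) z -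
    Y2 M h N g f (r z) *\<^sub>R (complex_hessian (\<lambda>\<zeta>. complex_of_real (ln (inverse (H \<zeta>)))) z
          + complex_hessian (\<lambda>\<zeta>. complex_of_real (ln (inverse (H1 \<zeta>)))) z))"
    by (intro semi_positive_weighted_norm[OF op z])
  then show ?thesis
    unfolding i_ddbar_def rz H_def H1_def W_def X_def by (simp add: r_def z_def)
qed

text \<open>The chosen value of the form stems from some homogeneous coordinates because at least one such system
exists; the same holds for covectors below.\<close>

lemma i_ddbar_log_inv_H_cases:
  assumes q: "q \<in> fst patch"
  obtains c' U \<sigma> where "c' \<in> charts M" "hom_coords patch q base_pt t_line c' U \<sigma>"
      "i_ddbar_log_inv_H M h patch q = i_ddbar (\<lambda>r. ln (inverse (herm (h c' (base_pt r)) (\<sigma> r c')))) patch q"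
proof -
  let ?P = "\<lambda>B. \<exists>c\<in>charts M. \<exists>U \<sigma>. hom_coords patch q base_pt t_line c U \<sigma> \<and>
     B = i_ddbar (\<lambda>r. ln (inverse (herm (h c (base_pt r)) (\<sigma> r c)))) patch q"
  have "\<exists>B. ?P B" using hom_coords_exist(1)[OF q] c by blast
  from someI_ex[OF this] show thesis
    using that unfolding i_ddbar_log_inv_H_def i_ddbar_log_inv_def by blast
qed

lemma i_ddbar_log_inv_H1_cases:
  assumes q: "q \<in> fst patch"
  obtains d' U \<tau> where "d' \<in> charts N" "hom_coords patch q (f \<circ> base_pt) ct_line d' U \<tau>"
      "i_ddbar_log_inv_H1 N g f patch q =
         i_ddbar (\<lambda>r. ln (inverse (herm (dual_metric g d' ((f \<circ> base_pt) r)) (\<tau> r d')))) patch q"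
proof -
  let ?P = "\<lambda>B. \<exists>c\<in>charts N. \<exists>U \<sigma>. hom_coords patch q (f \<circ> base_pt) ct_line c U \<sigma> \<and>
     B = i_ddbar (\<lambda>r. ln (inverse (herm (dual_metric g c ((f \<circ> base_pt) r)) (\<sigma> r c)))) patch q"
  have "\<exists>B. ?P B" using hom_coords_exist(2)[OF q] d by blast
  from someI_ex[OF this] show thesis
    using that unfolding i_ddbar_log_inv_H1_def i_ddbar_log_inv_def by blast
qed

lemma patch_inequality:
  fixes h :: "('a, 'm) metric" and g :: "('b, 'n) metric"
  assumes h: "hermitian_metric M h" and g: "hermitian_metric N g" and q: "q \<in> fst patch"
  shows "semi_positive (i_ddbar (Y2 M h N g f) patch q - Y2 M h N g f q *\<^sub>R
     (i_ddbar_log_inv_H M h patch q + i_ddbar_log_inv_H1 N g f patch q))"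
proof -
  obtain c' U \<sigma> where 1: "c' \<in> charts M" "hom_coords patch q base_pt t_line c' U \<sigma>"
      "i_ddbar_log_inv_H M h patch q = i_ddbar (\<lambda>r. ln (inverse (herm (h c' (base_pt r)) (\<sigma> r c')))) patch q"
    by (rule i_ddbar_log_inv_H_cases[OF q])
  obtain d' U' \<tau> where 2: "d' \<in> charts N" "hom_coords patch q (f \<circ> base_pt) ct_line d' U' \<tau>"
      "i_ddbar_log_inv_H1 N g f patch q =
         i_ddbar (\<lambda>r. ln (inverse (herm (dual_metric g d' ((f \<circ> base_pt) r)) (\<tau> r d')))) patch q"
    by (rule i_ddbar_log_inv_H1_cases[OF q])
  show ?thesis
    unfolding 1(3) 2(3) by (rule hessian_inequality[OF h g q 1(1,2) 2(1,2)])
qed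

end

theorem proposition1p5:
  fixes M :: "('a, 'm::finite) cmanifold" and h :: "('a, 'm) metric"
    and N :: "('b, 'n::finite) cmanifold" and g :: "('b, 'n) metric"
    and f :: "'a \<Rightarrow> 'b"
    and P :: "(('a, 'm, 'b, 'n) ppoint, 'd::finite) cmanifold"
  assumes "complex_manifold M" and "hermitian_metric M h"
    and "complex_manifold N" and "hermitian_metric N g"
    and "holomorphic_map M N f"
    and "CARD('d) + 2 = 2 * CARD('m) + CARD('n)"
    and "P = PfT_manifold M N f"
  shows "form_ge P (i_ddbar (Y2 M h N g f))
    (\<lambda>k q. Y2 M h N g f q *\<^sub>R (i_ddbar_log_inv_H M h k q + i_ddbar_log_inv_H1 N g f k q))"
  unfolding form_ge_def
proof (intro ballI)
  fix k q assume k: "k \<in> charts P" and q: "q \<in> fst k"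
  obtain c d \<alpha> i e where k_eq: "k = PfT_chart M N f c d \<alpha> i e"
    and c: "c \<in> charts M" "d \<in> charts N" "bij_betw e UNIV (coord_index \<alpha> i)"
    using k by (auto simp: assms(7) PfT_manifold_def PfT_charts_def)
  show "semi_positive (i_ddbar (Y2 M h N g f) k q -
      Y2 M h N g f q *\<^sub>R (i_ddbar_log_inv_H M h k q + i_ddbar_log_inv_H1 N g f k q))"
    unfolding k_eq by (rule patch_inequality[OF assms(1,3,5) c assms(2,4) q[unfolded k_eq]])
qed

end
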